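(* Let $(X,d)$ be a compact pointed metric space such that $\mathrm{lip}_0(X)$ separates points uniformly, let $((x_n,y_n))_{n=1}^\infty$ be a sequence of distinct points in $\widetilde X$, let $T$ be its Lipschitz interpolating operator, and let $M\geq 1$. The following statements are equivalent: (i) $((x_n,y_n))_{n=1}^\infty$ is Lipschitz interpolating for $\mathrm{Lip}_0(X)$ and its Lipschitz interpolation constant is $M$. (ii) The operator $S:\ell_1\to\mathcal F(X)$ defined by $S(e_n)=m_{x_n,y_n}$ (i.e. $S(\lambda)=\sum_n\lambda_n m_{x_n,y_n}$) is an into isomorphism and $\frac1M=\max\{J>0: J\|\lambda\|_1\le\|S(\lambda)\|\ \forall\lambda\in\ell_1\}$. (iii) $((x_n,y_n))_{n=1}^\infty$ is Lipschitz $c_0$-interpolating for $\mathrm{lip}_0(X)$, i.e. for every $\alpha\in c_0$ there is $f\in\mathrm{lip}_0(X)$ with $T(f)=\alpha$, and $M=\inf\{K>0: \forall\alpha\in c_0,\ \|\alpha\|_\infty\le1,\ \exists f\in\mathrm{lip}_0(X),\ \|f\|\le K,\ T(f)=\alpha\}$. (iv) $M=\inf\{K>0: \forall \alpha\in c_0,\ \|\alpha\|_\infty\le 1,\ \exists f\in\mathrm{Lip}_0(X),\ \|f\|\le K,\ T(f)=\alpha\}$ (and in particular this set of constants is nonempty).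
   Context: All spaces are real. $(X,d)$ has a base point $0$, $\widetilde{X}=\{(x,y)\in X\times X: x\neq y\}$. $\mathrm{Lip}_0(X)$ is the Banach space of Lipschitz $f:X\to\mathbb{R}$ with $f(0)=0$, normed by $\|f\|=\sup_{(x,y)\in\widetilde X}|f(x)-f(y)|/d(x,y)$. $\mathrm{lip}_0(X)$ is the closed subspace of those $f$ such that for every $\varepsilon>0$ there is $\delta>0$ with $|f(x)-f(y)|/d(x,y)<\varepsilon$ whenever $0<d(x,y)<\delta$. $\mathrm{lip}_0(X)$ separates points uniformly if there is a constant $a>1$ such that for all $x,y\in X$ some $f\in\mathrm{lip}_0(X)$ has $\|f\|\le a$ and $|f(x)-f(y)|=d(x,y)$. For $x\in X$, $\delta_x\in\mathrm{Lip}_0(X)^*$ is $\delta_x(f)=f(x)$; $\mathcal F(X)$ is the closed linear span of $\{\delta_x\}$ in $\mathrm{Lip}_0(X)^*$; $m_{x,y}=(\delta_x-\delta_y)/d(x,y)$. $e_n$ are the unit vectors of $\ell_1$. The Lipschitz interpolating operator of the sequence is $T(f)=\big((f(x_n)-f(y_n))/d(x_n,y_n)\big)_{n}$ for $f\in\mathrm{Lip}_0(X)$. The sequence is Lipschitz interpolating for $\mathrm{Lip}_0(X)$ if $T:\mathrm{Lip}_0(X)\to\ell_\infty$ is surjective, and then its Lipschitz interpolation constant is $\inf\{K\geq1:\forall\alpha\in\ell_\infty,\|\alpha\|_\infty\le1,\ \exists f\in\mathrm{Lip}_0(X),\ \|f\|\le K,\ T(f)=\alpha\}$. *)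

theory Defs
  imports "HOL-Analysis.Analysis"
begin

text \<open>The pointed metric space is a set X in a metric space type with base point z \<in> X.
  Lipschitz functions are real-valued functions; only their values on X matter.\<close>

definition lipnorm :: "'a::metric_space set \<Rightarrow> ('a \<Rightarrow> real) \<Rightarrow> real" where
  "lipnorm X f = (SUP p \<in> {(x, y). x \<in> X \<and> y \<in> X \<and> x \<noteq> y}.
                    \<bar>f (fst p) - f (snd p)\<bar> / dist (fst p) (snd p))"

definition Lip0 :: "'a::metric_space set \<Rightarrow> 'a \<Rightarrow> ('a \<Rightarrow> real) set" where
  "Lip0 X z = {f. f z = 0 \<and> (\<exists>L. \<forall>x\<in>X. \<forall>y\<in>X. \<bar>f x - f y\<bar> \<le> L * dist x y)}"

definition lip0 :: "'a::metric_space set \<Rightarrow> 'a \<Rightarrow> ('a \<Rightarrow> real) set" where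
  "lip0 X z = {f \<in> Lip0 X z. \<forall>\<epsilon>>0. \<exists>\<delta>>0. \<forall>x\<in>X. \<forall>y\<in>X.
       0 < dist x y \<and> dist x y < \<delta> \<longrightarrow> \<bar>f x - f y\<bar> / dist x y < \<epsilon>}"

definition separates_points_uniformly :: "'a::metric_space set \<Rightarrow> 'a \<Rightarrow> bool" where
  "separates_points_uniformly X z \<longleftrightarrow> (\<exists>a>1. \<forall>x\<in>X. \<forall>y\<in>X.
       \<exists>f \<in> lip0 X z. lipnorm X f \<le> a \<and> \<bar>f x - f y\<bar> = dist x y)"

definition interp_op :: "(nat \<Rightarrow> 'a::metric_space) \<Rightarrow> (nat \<Rightarrow> 'a) \<Rightarrow> ('a \<Rightarrow> real) \<Rightarrow> nat \<Rightarrow> real" where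
  "interp_op xs ys f n = (f (xs n) - f (ys n)) / dist (xs n) (ys n)"

definition linfty :: "(nat \<Rightarrow> real) set" where
  "linfty = {\<alpha>. bounded (range \<alpha>)}"

definition c0 :: "(nat \<Rightarrow> real) set" where
  "c0 = {\<alpha>. \<alpha> \<longlonglongrightarrow> 0}"

definition l1 :: "(nat \<Rightarrow> real) set" where
  "l1 = {lam. summable (\<lambda>n. \<bar>lam n\<bar>)}"

definition l1norm :: "(nat \<Rightarrow> real) \<Rightarrow> real" where
  "l1norm lam = (\<Sum>n. \<bar>lam n\<bar>)"

definition Lip_interpolating :: "'a::metric_space set \<Rightarrow> 'a \<Rightarrow> (nat \<Rightarrow> 'a) \<Rightarrow> (nat \<Rightarrow> 'a) \<Rightarrow> bool" where
  "Lip_interpolating X z xs ys \<longleftrightarrow> (\<forall>\<alpha>\<in>linfty. \<exists>f\<in>Lip0 X z. interp_op xs ys f = \<alpha>)"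

definition Lip_interp_constants :: "'a::metric_space set \<Rightarrow> 'a \<Rightarrow> (nat \<Rightarrow> 'a) \<Rightarrow> (nat \<Rightarrow> 'a) \<Rightarrow> real set" where
  "Lip_interp_constants X z xs ys = {K. K \<ge> 1 \<and> (\<forall>\<alpha>\<in>linfty. (\<forall>n. \<bar>\<alpha> n\<bar> \<le> 1) \<longrightarrow>
       (\<exists>f\<in>Lip0 X z. lipnorm X f \<le> K \<and> interp_op xs ys f = \<alpha>))}"

definition Lip_interp_constant :: "'a::metric_space set \<Rightarrow> 'a \<Rightarrow> (nat \<Rightarrow> 'a) \<Rightarrow> (nat \<Rightarrow> 'a) \<Rightarrow> real" where
  "Lip_interp_constant X z xs ys = Inf (Lip_interp_constants X z xs ys)"

definition c0_interp_constants :: "'a::metric_space set \<Rightarrow> ('a \<Rightarrow> real) set \<Rightarrow> (nat \<Rightarrow> 'a) \<Rightarrow> (nat \<Rightarrow> 'a) \<Rightarrow> real set" where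
  "c0_interp_constants X F xs ys = {K. K > 0 \<and> (\<forall>\<alpha>\<in>c0. (\<forall>n. \<bar>\<alpha> n\<bar> \<le> 1) \<longrightarrow>
       (\<exists>f\<in>F. lipnorm X f \<le> K \<and> interp_op xs ys f = \<alpha>))}"

definition Lip_c0_interpolating :: "('a \<Rightarrow> real) set \<Rightarrow> (nat \<Rightarrow> 'a::metric_space) \<Rightarrow> (nat \<Rightarrow> 'a) \<Rightarrow> bool" where
  "Lip_c0_interpolating F xs ys \<longleftrightarrow> (\<forall>\<alpha>\<in>c0. \<exists>f\<in>F. interp_op xs ys f = \<alpha>)"

definition dual_norm :: "'a::metric_space set \<Rightarrow> 'a \<Rightarrow> (('a \<Rightarrow> real) \<Rightarrow> real) \<Rightarrow> real" where
  "dual_norm X z \<phi> = Sup {\<bar>\<phi> f\<bar> | f. f \<in> Lip0 X z \<and> lipnorm X f \<le> 1}"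

text \<open>The operator S : l1 \<rightarrow> F(X), S(lam) = \<Sum> lam_n m_{x_n,y_n}, as an element of Lip0(X)^*:
  S(lam)(f) = \<Sum> lam_n (f(x_n) - f(y_n))/d(x_n,y_n).\<close>
definition Sop :: "(nat \<Rightarrow> 'a::metric_space) \<Rightarrow> (nat \<Rightarrow> 'a) \<Rightarrow> (nat \<Rightarrow> real) \<Rightarrow> ('a \<Rightarrow> real) \<Rightarrow> real" where
  "Sop xs ys lam f = (\<Sum>n. lam n * interp_op xs ys f n)"

definition Sop_into_isomorphism :: "'a::metric_space set \<Rightarrow> 'a \<Rightarrow> (nat \<Rightarrow> 'a) \<Rightarrow> (nat \<Rightarrow> 'a) \<Rightarrow> bool" where
  "Sop_into_isomorphism X z xs ys \<longleftrightarrow> (\<exists>c>0. \<exists>C. \<forall>lam\<in>l1.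
       c * l1norm lam \<le> dual_norm X z (Sop xs ys lam) \<and> dual_norm X z (Sop xs ys lam) \<le> C * l1norm lam)"

definition Sop_lower_constants :: "'a::metric_space set \<Rightarrow> 'a \<Rightarrow> (nat \<Rightarrow> 'a) \<Rightarrow> (nat \<Rightarrow> 'a) \<Rightarrow> real set" where
  "Sop_lower_constants X z xs ys = {J. J > 0 \<and> (\<forall>lam\<in>l1. J * l1norm lam \<le> dual_norm X z (Sop xs ys lam))}"

end

theory Submission
  imports Defs
begin

text \<open>
  A constant \<open>K\<close> is admissible for interpolation of null sequences by \<open>Lip\<^sub>0\<close> functions iff
  \<open>\<parallel>\<lambda>\<parallel>\<^sub>1 \<le> K \<parallel>S \<lambda>\<parallel>\<close> for all \<open>\<lambda> \<in> \<ell>\<^sub>1\<close>. Necessity is seen by interpolating the signs of a finite piece of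
  \<open>\<lambda>\<close>. Conversely, the ball of radius \<open>K\<close> is compact for pointwise convergence, a least-squares argument
  yields interpolation at finitely many pairs, and compactness yields interpolation of every bounded
  sequence. Hence the admissible constants in (i) and (iv) coincide, they are the reciprocals of those in
  (ii), and their infimum is attained.

  For (iii), uniform separation and the lattice operations yield little Lipschitz functions that agree
  with a given \<open>f\<close> on a finite net, at the price of a factor \<open>a\<close> in the norm. Averaging a sequence of such
  functions chosen by a gliding hump removes this factor, and the average interpolates up to \<open>\<eta>\<close> when
  \<open>T f \<in> c\<^sub>0\<close>. Interpolation forces \<open>d(x\<^sub>n, y\<^sub>n) \<longrightarrow> 0\<close>, so \<open>T\<close> maps \<open>lip\<^sub>0\<close> into \<open>c\<^sub>0\<close>, and the error is
  removed by iteration, at an arbitrarily small cost in the norm.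
\<close>

section \<open>Lipschitz balls and flatness near the diagonal\<close>

text \<open>Increment bounds avoid the supremum in \<open>lipnorm\<close>, which carries no
  information when the quotients are unbounded.\<close>

definition lipball :: "'a::metric_space set \<Rightarrow> 'a \<Rightarrow> real \<Rightarrow> ('a \<Rightarrow> real) set" where
  "lipball X z K = {f. f z = 0 \<and> (\<forall>x\<in>X. \<forall>y\<in>X. \<bar>f x - f y\<bar> \<le> K * dist x y)}"

text \<open>The condition that singles out \<open>lip0\<close>, multiplied out so that coinciding
  points need no exception, and kept apart from the Lipschitz bound.\<close>

definition little_lip :: "'a::metric_space set \<Rightarrow> ('a \<Rightarrow> real) \<Rightarrow> bool" where
  "little_lip X f \<longleftrightarrow> (\<forall>\<epsilon>>0. \<exists>\<delta>>0. \<forall>x\<in>X. \<forall>y\<in>X. dist x y < \<delta> \<longrightarrow> \<bar>f x - f y\<bar> \<le> \<epsilon> * dist x y)"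

lemma lipballI:
  assumes "f z = 0" "\<And>x y. x \<in> X \<Longrightarrow> y \<in> X \<Longrightarrow> \<bar>f x - f y\<bar> \<le> K * dist x y"
  shows "f \<in> lipball X z K"
  using assms by (auto simp: lipball_def)

lemma lipballD:
  assumes "f \<in> lipball X z K"
  shows "f z = 0" "\<And>x y. x \<in> X \<Longrightarrow> y \<in> X \<Longrightarrow> \<bar>f x - f y\<bar> \<le> K * dist x y"
  using assms by (auto simp: lipball_def)

lemma lipball_mono:
  assumes "f \<in> lipball X z K" "K \<le> L"
  shows "f \<in> lipball X z L"
proof (rule lipballI)
  show "f z = 0" using assms by (simp add: lipball_def)
  fix x y assume "x \<in> X" "y \<in> X"
  then have "\<bar>f x - f y\<bar> \<le> K * dist x y" using assms by (simp add: lipball_def)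
  also have "\<dots> \<le> L * dist x y" using assms by (simp add: mult_right_mono)
  finally show "\<bar>f x - f y\<bar> \<le> L * dist x y" .
qed

lemma lipball_scale:
  assumes "f \<in> lipball X z K" "c * K \<le> L" "0 \<le> c"
  shows "(\<lambda>x. c * f x) \<in> lipball X z L"
proof (rule lipball_mono[OF _ assms(2)], rule lipballI)
  show "c * f z = 0" using assms by (simp add: lipball_def)
  fix x y assume "x \<in> X" "y \<in> X"
  then have "c * \<bar>f x - f y\<bar> \<le> c * (K * dist x y)"
    using assms by (simp add: lipball_def mult_left_mono)
  then show "\<bar>c * f x - c * f y\<bar> \<le> c * K * dist x y"
    using \<open>0 \<le> c\<close> by (simp add: abs_mult mult.assoc flip: right_diff_distrib)
qed

lemma lipball_subset_Lip0: "f \<in> lipball X z K \<Longrightarrow> f \<in> Lip0 X z"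
  by (auto simp: lipball_def Lip0_def)

lemma Lip0_in_lipball:
  assumes "f \<in> Lip0 X z"
  obtains K where "K > 0" "f \<in> lipball X z K"
proof -
  obtain L where L: "f z = 0" "\<forall>x\<in>X. \<forall>y\<in>X. \<bar>f x - f y\<bar> \<le> L * dist x y"
    using assms by (auto simp: Lip0_def)
  then have "f \<in> lipball X z L" by (auto simp: lipball_def)
  then have "f \<in> lipball X z (max 1 L)" by (rule lipball_mono) simp
  then show thesis by (intro that[of "max 1 L"]) auto
qed

text \<open>Membership in \<open>Lip0\<close> bounds the quotients, so that the supremum dominates
  each of them; the pair \<open>p\<close>, \<open>q\<close> makes their set nonempty, so that a
  common bound also bounds the supremum.\<close>

lemma Lip0_lipnorm_le_iff:
  assumes "p \<in> X" "q \<in> X" "p \<noteq> q"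
  shows "f \<in> Lip0 X z \<and> lipnorm X f \<le> K \<longleftrightarrow> f \<in> lipball X z K"
proof
  let ?P = "{(x, y). x \<in> X \<and> y \<in> X \<and> x \<noteq> y}"
  let ?Q = "\<lambda>p. \<bar>f (fst p) - f (snd p)\<bar> / dist (fst p) (snd p)"
  assume f: "f \<in> Lip0 X z \<and> lipnorm X f \<le> K"
  then obtain L where L: "f \<in> lipball X z L" using Lip0_in_lipball by metis
  have bdd: "bdd_above (?Q ` ?P)"
    using L by (intro bdd_aboveI[of _ L]) (auto simp: lipball_def field_simps)
  show "f \<in> lipball X z K"
  proof (rule lipballI)
    show "f z = 0" using f by (simp add: Lip0_def)
    fix x y assume xy: "x \<in> X" "y \<in> X"
    show "\<bar>f x - f y\<bar> \<le> K * dist x y"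
    proof (cases "x = y")
      case False
      then have "?Q (x, y) \<le> lipnorm X f"
        unfolding lipnorm_def using xy by (intro cSUP_upper bdd) auto
      then have "?Q (x, y) \<le> K" using f by linarith
      then show ?thesis using False by (simp add: field_simps)
    qed simp
  qed
next
  assume f: "f \<in> lipball X z K"
  have "lipnorm X f \<le> K"
    unfolding lipnorm_def using assms f
    by (intro cSUP_least) (auto simp: lipball_def field_simps)
  then show "f \<in> Lip0 X z \<and> lipnorm X f \<le> K" using f lipball_subset_Lip0 by blast
qed

lemma lip0_iff: "f \<in> lip0 X z \<longleftrightarrow> f \<in> Lip0 X z \<and> little_lip X f"
proof
  assume f: "f \<in> lip0 X z"
  have "little_lip X f" unfolding little_lip_def
  proof (intro allI impI)
    fix e :: real assume "e > 0"
    then obtain d where d: "d > 0" "\<forall>x\<in>X. \<forall>y\<in>X.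
       0 < dist x y \<and> dist x y < d \<longrightarrow> \<bar>f x - f y\<bar> / dist x y < e"
      using f unfolding lip0_def by blast
    have "\<bar>f x - f y\<bar> \<le> e * dist x y" if "x \<in> X" "y \<in> X" "dist x y < d" for x y
    proof (cases "x = y")
      case False
      then have "\<bar>f x - f y\<bar> / dist x y < e" using d that by simp
      then show ?thesis using False by (simp add: field_simps)
    qed simp
    then show "\<exists>\<delta>>0. \<forall>x\<in>X. \<forall>y\<in>X. dist x y < \<delta> \<longrightarrow> \<bar>f x - f y\<bar> \<le> e * dist x y"
      using d(1) by blast
  qed
  then show "f \<in> Lip0 X z \<and> little_lip X f" using f by (simp add: lip0_def)
next
  assume f: "f \<in> Lip0 X z \<and> little_lip X f"
  have "\<exists>\<delta>>0. \<forall>x\<in>X. \<forall>y\<in>X. 0 < dist x y \<and> dist x y < \<delta> \<longrightarrow> \<bar>f x - f y\<bar> / dist x y < e"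
    if "e > 0" for e
  proof -
    obtain d where d: "d > 0" "\<forall>x\<in>X. \<forall>y\<in>X. dist x y < d \<longrightarrow> \<bar>f x - f y\<bar> \<le> e/2 * dist x y"
      using f \<open>e > 0\<close> unfolding little_lip_def by (meson half_gt_zero)
    have "\<bar>f x - f y\<bar> / dist x y < e" if "x \<in> X" "y \<in> X" "0 < dist x y" "dist x y < d" for x y
    proof -
      have "\<bar>f x - f y\<bar> / dist x y \<le> e/2" using d that by (simp add: field_simps)
      then show ?thesis using \<open>e > 0\<close> by linarith
    qed
    then show ?thesis using d(1) by blast
  qed
  then show "f \<in> lip0 X z" using f by (simp add: lip0_def)
qed

lemma little_lip_scale:
  assumes "little_lip X f"
  shows "little_lip X (\<lambda>x. c * f x)"
  unfolding little_lip_def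
proof (intro allI impI)
  fix e :: real assume "e > 0"
  then have "e / (\<bar>c\<bar> + 1) > 0" by (simp add: add_nonneg_pos)
  then obtain d where d: "d > 0"
      "\<forall>x\<in>X. \<forall>y\<in>X. dist x y < d \<longrightarrow> \<bar>f x - f y\<bar> \<le> e / (\<bar>c\<bar> + 1) * dist x y"
    using assms unfolding little_lip_def by meson
  have "\<bar>c * f x - c * f y\<bar> \<le> e * dist x y" if "x \<in> X" "y \<in> X" "dist x y < d" for x y
  proof -
    have "\<bar>c * f x - c * f y\<bar> = \<bar>c\<bar> * \<bar>f x - f y\<bar>" by (simp add: abs_mult flip: right_diff_distrib)
    also have "\<dots> \<le> (\<bar>c\<bar> + 1) * (e / (\<bar>c\<bar> + 1) * dist x y)"
      using d that by (intro mult_mono) auto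
    also have "\<dots> = e * dist x y" by (simp add: add_nonneg_pos)
    finally show ?thesis .
  qed
  then show "\<exists>\<delta>>0. \<forall>x\<in>X. \<forall>y\<in>X. dist x y < \<delta> \<longrightarrow> \<bar>c * f x - c * f y\<bar> \<le> e * dist x y"
    using d(1) by blast
qed

text \<open>The hypothesis on \<open>f\<close> is what finite sums, maxima and minima have in common.\<close>

lemma little_lip_finite_comb:
  assumes "finite I" and "\<And>i. i \<in> I \<Longrightarrow> little_lip X (F i)" and "C > 0"
    and F: "\<And>x y e. x \<in> X \<Longrightarrow> y \<in> X \<Longrightarrow> (\<And>i. i \<in> I \<Longrightarrow> \<bar>F i x - F i y\<bar> \<le> e) \<Longrightarrow> e \<ge> 0 \<Longrightarrow> \<bar>f x - f y\<bar> \<le> C * e"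
  shows "little_lip X f"
  unfolding little_lip_def
proof (intro allI impI)
  fix e :: real assume "e > 0"
  then have e: "e / C > 0" using \<open>C > 0\<close> by simp
  have "\<exists>d>0. \<forall>i\<in>I. \<forall>x\<in>X. \<forall>y\<in>X. dist x y < d \<longrightarrow> \<bar>F i x - F i y\<bar> \<le> e / C * dist x y"
    using assms(1,2)
  proof (induction I rule: finite_induct)
    case empty
    then show ?case by (auto intro: exI[of _ 1])
  next
    case (insert j I)
    then obtain d where d: "d > 0"
        "\<forall>i\<in>I. \<forall>x\<in>X. \<forall>y\<in>X. dist x y < d \<longrightarrow> \<bar>F i x - F i y\<bar> \<le> e / C * dist x y" by auto
    obtain d' where d': "d' > 0"
        "\<forall>x\<in>X. \<forall>y\<in>X. dist x y < d' \<longrightarrow> \<bar>F j x - F j y\<bar> \<le> e / C * dist x y"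
      using insert.prems[of j] e unfolding little_lip_def by (meson insertI1)
    show ?case using d d' by (intro exI[of _ "min d d'"]) auto
  qed
  then obtain d where d: "d > 0"
    "\<forall>i\<in>I. \<forall>x\<in>X. \<forall>y\<in>X. dist x y < d \<longrightarrow> \<bar>F i x - F i y\<bar> \<le> e / C * dist x y" by blast
  have "\<bar>f x - f y\<bar> \<le> e * dist x y" if "x \<in> X" "y \<in> X" "dist x y < d" for x y
  proof -
    have "\<bar>f x - f y\<bar> \<le> C * (e / C * dist x y)"
    proof (rule F)
      show "0 \<le> e / C * dist x y" using mult_nonneg_nonneg[OF less_imp_le[OF e] zero_le_dist] .
    qed (use d that in auto)
    then show ?thesis using \<open>C > 0\<close> by simp
  qed
  then show "\<exists>\<delta>>0. \<forall>x\<in>X. \<forall>y\<in>X. dist x y < \<delta> \<longrightarrow> \<bar>f x - f y\<bar> \<le> e * dist x y"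
    using d(1) by blast
qed

lemma little_lip_sum:
  fixes G :: "nat \<Rightarrow> 'a::metric_space \<Rightarrow> real"
  assumes "\<And>k. k < N \<Longrightarrow> little_lip X (G k)"
  shows "little_lip X (\<lambda>x. \<Sum>k<N. G k x)"
proof (rule little_lip_finite_comb[where I = "{..<N}" and F = G and C = "real N + 1"])
  fix x y :: 'a and e :: real
  assume G: "\<And>i. i \<in> {..<N} \<Longrightarrow> \<bar>G i x - G i y\<bar> \<le> e" and "e \<ge> 0"
  have "\<bar>(\<Sum>k<N. G k x) - (\<Sum>k<N. G k y)\<bar> \<le> (\<Sum>k<N. \<bar>G k x - G k y\<bar>)"
    by (simp flip: sum_subtractf)
  also have "\<dots> \<le> (\<Sum>k<N. e)" using G by (intro sum_mono) auto
  also have "\<dots> \<le> (real N + 1) * e" using \<open>e \<ge> 0\<close> by (simp add: algebra_simps)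
  finally show "\<bar>(\<Sum>k<N. G k x) - (\<Sum>k<N. G k y)\<bar> \<le> (real N + 1) * e" .
qed (use assms in auto)

text \<open>This is closedness of \<open>lip0\<close> in the Lipschitz norm; it serves for the sum
  of a series of little Lipschitz functions.\<close>

lemma little_lip_approx:
  assumes "\<And>e. e > 0 \<Longrightarrow> \<exists>h. little_lip X h \<and> (\<forall>x\<in>X. \<forall>y\<in>X. \<bar>(f x - f y) - (h x - h y)\<bar> \<le> e * dist x y)"
  shows "little_lip X f"
  unfolding little_lip_def
proof (intro allI impI)
  fix e :: real assume "e > 0"
  then obtain h where h: "little_lip X h" "\<forall>x\<in>X. \<forall>y\<in>X. \<bar>(f x - f y) - (h x - h y)\<bar> \<le> e/2 * dist x y"
    using assms[of "e/2"] by auto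
  then obtain d where d: "d > 0" "\<forall>x\<in>X. \<forall>y\<in>X. dist x y < d \<longrightarrow> \<bar>h x - h y\<bar> \<le> e/2 * dist x y"
    unfolding little_lip_def using \<open>e > 0\<close> by (meson half_gt_zero)
  have "\<bar>f x - f y\<bar> \<le> e * dist x y" if "x \<in> X" "y \<in> X" "dist x y < d" for x y
  proof -
    have "\<bar>(f x - f y) - (h x - h y)\<bar> \<le> e/2 * dist x y" "\<bar>h x - h y\<bar> \<le> e/2 * dist x y"
      using h d that by auto
    moreover have "e * dist x y = e/2 * dist x y + e/2 * dist x y" by simp
    ultimately show ?thesis by linarith
  qed
  then show "\<exists>\<delta>>0. \<forall>x\<in>X. \<forall>y\<in>X. dist x y < \<delta> \<longrightarrow> \<bar>f x - f y\<bar> \<le> e * dist x y"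
    using d(1) by blast
qed

section \<open>From Lipschitz to little Lipschitz functions: finite sets, nets, gliding hump\<close>

text \<open>With \<open>u\<close> and \<open>v\<close> the values of finitely many functions at two
  points, this transfers a common increment bound to their maximum.\<close>

lemma abs_Max_diff_le:
  fixes u v :: "'b \<Rightarrow> real"
  assumes "finite A" "A \<noteq> {}" "\<And>i. i \<in> A \<Longrightarrow> \<bar>u i - v i\<bar> \<le> e"
  shows "\<bar>Max (u ` A) - Max (v ` A)\<bar> \<le> e"
proof -
  have "Max (u ` A) \<le> Max (v ` A) + e" if "\<And>i. i \<in> A \<Longrightarrow> \<bar>u i - v i\<bar> \<le> e" for u v :: "'b \<Rightarrow> real"
  proof (subst Max_le_iff)
    show "\<forall>a\<in>u ` A. a \<le> Max (v ` A) + e"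
    proof
      fix a assume "a \<in> u ` A"
      then obtain i where i: "i \<in> A" "a = u i" by blast
      have "v i \<le> Max (v ` A)" using i assms(1) by simp
      then show "a \<le> Max (v ` A) + e" using that[OF i(1)] i(2) by linarith
    qed
  qed (use assms in auto)
  from this[of u v] this[of v u] show ?thesis using assms(3) by (fastforce simp: abs_minus_commute abs_le_iff)
qed

lemma abs_Min_diff_le:
  fixes u v :: "'b \<Rightarrow> real"
  assumes "finite A" "A \<noteq> {}" "\<And>i. i \<in> A \<Longrightarrow> \<bar>u i - v i\<bar> \<le> e"
  shows "\<bar>Min (u ` A) - Min (v ` A)\<bar> \<le> e"
proof -
  have "Min (w ` A) = - Max ((\<lambda>i. - w i) ` A)" for w :: "'b \<Rightarrow> real"
  proof -
    have "- Min (w ` A) = Max (uminus ` w ` A)" by (rule minus_Min_eq_Max) (use assms in auto)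
    then show ?thesis unfolding image_image by linarith
  qed
  moreover have "\<bar>Max ((\<lambda>i. - u i) ` A) - Max ((\<lambda>i. - v i) ` A)\<bar> \<le> e"
    using assms by (intro abs_Max_diff_le) (auto simp: abs_minus_commute)
  ultimately show ?thesis by (simp add: abs_minus_commute)
qed

text \<open>The max-min formula is that of the lattice version of the Stone-Weierstrass theorem;
  lattice operations increase neither the Lipschitz constant nor the modulus of flatness.\<close>

lemma finite_interpolation_little_lip:
  assumes sep: "\<And>x y. x \<in> X \<Longrightarrow> y \<in> X \<Longrightarrow>
      \<exists>h\<in>lipball X z a. little_lip X h \<and> \<bar>h x - h y\<bar> = dist x y"
    and f: "f \<in> lipball X z K" and "K \<ge> 0" "a \<ge> 0"
    and A: "finite A" "A \<subseteq> X" "z \<in> A"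
  shows "\<exists>g\<in>lipball X z (K * a). little_lip X g \<and> (\<forall>t\<in>A. g t = f t)"
proof -
  have "\<exists>h. little_lip X h \<and> h x = f x \<and> h y = f y \<and> (\<forall>s\<in>X. \<forall>t\<in>X. \<bar>h s - h t\<bar> \<le> K * a * dist s t)"
    if xy: "x \<in> A" "y \<in> A" for x y
  proof (cases "x = y")
    case True
    show ?thesis using True \<open>K \<ge> 0\<close> \<open>a \<ge> 0\<close>
      by (intro exI[of _ "\<lambda>_. f x"]) (auto simp: little_lip_def intro: exI[of _ 1])
  next
    case False
    obtain h where h: "h \<in> lipball X z a" "little_lip X h" "\<bar>h x - h y\<bar> = dist x y"
      using sep[of x y] xy A by blast
    \<comment> \<open>Rescaling \<open>h\<close> gives it the increment of \<open>f\<close> between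
      \<open>x\<close> and \<open>y\<close>; as that increment of \<open>h\<close> has size
      \<open>dist x y\<close>, the factor is at most \<open>K\<close>.\<close>
    define c where "c = (f x - f y) / (h x - h y)"
    have ne: "h x - h y \<noteq> 0" using h(3) False by auto
    have "\<bar>f x - f y\<bar> \<le> K * dist x y" using lipballD(2)[OF f] xy A by auto
    then have c: "\<bar>c\<bar> \<le> K" unfolding c_def using h(3) False by (simp add: field_simps)
    define g where "g = (\<lambda>t. f y + c * (h t - h y))"
    have gd: "g s - g t = c * h s - c * h t" for s t by (simp add: g_def algebra_simps)
    have "little_lip X g"
      using little_lip_scale[OF h(2), of c] by (simp add: little_lip_def gd)
    moreover have "g x = f x" "g y = f y" using ne by (auto simp: g_def c_def)
    moreover have "\<bar>g s - g t\<bar> \<le> K * a * dist s t" if "s \<in> X" "t \<in> X" for s t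
    proof -
      have "\<bar>g s - g t\<bar> = \<bar>c\<bar> * \<bar>h s - h t\<bar>"
        unfolding gd by (simp add: abs_mult flip: right_diff_distrib)
      also have "\<dots> \<le> K * (a * dist s t)"
        using c lipballD(2)[OF h(1)] that \<open>K \<ge> 0\<close> by (intro mult_mono) auto
      finally show ?thesis by simp
    qed
    ultimately show ?thesis by blast
  qed
  then obtain H where H: "\<And>x y. x \<in> A \<Longrightarrow> y \<in> A \<Longrightarrow> little_lip X (H x y) \<and> H x y x = f x \<and> H x y y = f y
      \<and> (\<forall>s\<in>X. \<forall>t\<in>X. \<bar>H x y s - H x y t\<bar> \<le> K * a * dist s t)" by metis
  define g where "g = (\<lambda>t. Max ((\<lambda>x. Min ((\<lambda>y. H x y t) ` A)) ` A))"
  have ne: "A \<noteq> {}" using A by auto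
  have gdiff: "\<bar>g s - g t\<bar> \<le> e" if "\<And>x y. x \<in> A \<Longrightarrow> y \<in> A \<Longrightarrow> \<bar>H x y s - H x y t\<bar> \<le> e" for s t e
    unfolding g_def using that A ne by (intro abs_Max_diff_le abs_Min_diff_le) auto
  have "little_lip X g"
  proof (rule little_lip_finite_comb[where I = "A \<times> A" and F = "\<lambda>(x, y). H x y" and C = 1])
    fix x y e
    assume "\<And>i. i \<in> A \<times> A \<Longrightarrow> \<bar>(case i of (u, v) \<Rightarrow> H u v) x - (case i of (u, v) \<Rightarrow> H u v) y\<bar> \<le> e"
    then show "\<bar>g x - g y\<bar> \<le> 1 * e" using gdiff[of x y e] by fastforce
  qed (use A H in auto)
  \<comment> \<open>For \<open>t\<close> in \<open>A\<close>, every inner minimum is at most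
    \<open>H x t t = f t\<close>, and the one with \<open>x = t\<close> equals
    \<open>f t\<close>.\<close>
  moreover have gf: "g t = f t" if "t \<in> A" for t
  proof (rule antisym)
    show "g t \<le> f t" unfolding g_def
    proof (subst Max_le_iff)
      show "\<forall>u\<in>(\<lambda>x. Min ((\<lambda>y. H x y t) ` A)) ` A. u \<le> f t"
      proof
        fix u assume "u \<in> (\<lambda>x. Min ((\<lambda>y. H x y t) ` A)) ` A"
        then obtain x where x: "x \<in> A" "u = Min ((\<lambda>y. H x y t) ` A)" by blast
        have "u \<le> H x t t" unfolding x(2) using A that by (intro Min_le) auto
        then show "u \<le> f t" using H x that by simp
      qed
    qed (use A ne in auto)
    have "(\<lambda>y. H t y t) ` A = {f t}" using H that by auto
    then have "Min ((\<lambda>y. H t y t) ` A) = f t" by simp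
    then show "f t \<le> g t"
      unfolding g_def using A that by (intro Max_ge) (auto intro!: image_eqI[of _ _ t])
  qed
  moreover have "g \<in> lipball X z (K * a)"
  proof (rule lipballI)
    show "g z = 0" using gf[OF A(3)] lipballD(1)[OF f] by simp
  qed (use H in \<open>auto intro!: gdiff\<close>)
  ultimately show ?thesis by blast
qed

text \<open>Agreement on an \<open>r\<close>-net makes \<open>g\<close> uniformly close to
  \<open>f\<close>, both being Lipschitz, and a uniform error is small relative to
  \<open>dist x y\<close> once the distance is at least \<open>d\<close>.\<close>

lemma approx_away_from_diagonal:
  assumes "compact X" "z \<in> X"
    and sep: "\<And>x y. x \<in> X \<Longrightarrow> y \<in> X \<Longrightarrow>
      \<exists>h\<in>lipball X z a. little_lip X h \<and> \<bar>h x - h y\<bar> = dist x y"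
    and f: "f \<in> lipball X z K" and "K \<ge> 0" "a \<ge> 0" and "d > 0" "e > 0"
  shows "\<exists>g\<in>lipball X z (K * a). little_lip X g \<and>
     (\<forall>x\<in>X. \<forall>y\<in>X. dist x y \<ge> d \<longrightarrow> \<bar>(g x - g y) - (f x - f y)\<bar> \<le> e * dist x y)"
proof -
  \<comment> \<open>\<open>C\<close> covers the Lipschitz constants of \<open>f\<close> and
    \<open>g\<close> together, with \<open>+ 1\<close> to keep it positive; \<open>r\<close> is such
    that errors \<open>C * r\<close> at two points add up to \<open>e * d\<close>.\<close>
  define C where "C = K + K * a + 1"
  have C: "C > 0" using assms by (simp add: C_def add_nonneg_pos)
  define r where "r = e * d / (2 * C)"
  have "r > 0" using C assms by (simp add: r_def)
  obtain A where A: "finite A" "A \<subseteq> X" "X \<subseteq> (\<Union>x\<in>A. ball x r)"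
    using compactE_image[OF \<open>compact X\<close>, of X "\<lambda>x. ball x r"] \<open>r > 0\<close> by force
  obtain g where g: "g \<in> lipball X z (K * a)" "little_lip X g" "\<forall>t\<in>insert z A. g t = f t"
    using finite_interpolation_little_lip[OF sep f \<open>K \<ge> 0\<close> \<open>a \<ge> 0\<close>, of "insert z A"] A \<open>z \<in> X\<close> by blast
  have gf: "\<bar>g x - f x\<bar> \<le> C * r" if xX: "x \<in> X" for x
  proof -
    obtain t where t: "t \<in> A" "dist t x < r" using A xX by auto
    have tX: "t \<in> X" using A t by blast
    have "\<bar>g x - g t\<bar> \<le> K * a * dist x t" "\<bar>f x - f t\<bar> \<le> K * dist x t"
      using lipballD(2)[OF g(1) xX tX] lipballD(2)[OF f xX tX] by auto
    moreover have "g t = f t" using g t by blast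
    moreover have "K * a * dist x t + K * dist x t \<le> C * r"
    proof -
      have "(K * a + K) * dist x t \<le> C * r"
        using t assms C by (intro mult_mono) (auto simp: C_def dist_commute)
      then show ?thesis by (simp add: algebra_simps)
    qed
    ultimately show ?thesis by linarith
  qed
  have "\<bar>(g x - g y) - (f x - f y)\<bar> \<le> e * dist x y" if "x \<in> X" "y \<in> X" "dist x y \<ge> d" for x y
  proof -
    have "\<bar>(g x - g y) - (f x - f y)\<bar> \<le> C * r + C * r" using gf[of x] gf[of y] that by linarith
    also have "\<dots> = e * d" using C by (simp add: r_def field_simps)
    also have "\<dots> \<le> e * dist x y" using that \<open>e > 0\<close> by simp
    finally show ?thesis .
  qed
  then show ?thesis using g by blast
qed

text \<open>Gliding hump: at each scale all but one of the \<open>g k\<close> are either nearly flat or close to \<open>f\<close>,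
  so averaging brings the Lipschitz constant down from that of the \<open>g k\<close> to that of \<open>f\<close>.\<close>

lemma gliding_hump:
  assumes approx: "\<And>d e. d > 0 \<Longrightarrow> e > 0 \<Longrightarrow> \<exists>g\<in>lipball X z C. little_lip X g \<and>
     (\<forall>x\<in>X. \<forall>y\<in>X. dist x y \<ge> d \<longrightarrow> \<bar>(g x - g y) - (f x - f y)\<bar> \<le> e * dist x y)"
    and "d0 > 0" "e > 0"
  obtains g where "\<And>k::nat. g k \<in> lipball X z C" "\<And>k. little_lip X (g k)"
    "\<And>k x y. x \<in> X \<Longrightarrow> y \<in> X \<Longrightarrow> dist x y \<ge> d0 \<Longrightarrow> \<bar>(g k x - g k y) - (f x - f y)\<bar> \<le> e * dist x y"
    "\<And>x y. x \<in> X \<Longrightarrow> y \<in> X \<Longrightarrow> \<exists>j. \<forall>k. k \<noteq> j \<longrightarrow>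
        \<bar>g k x - g k y\<bar> \<le> e * dist x y \<or> \<bar>(g k x - g k y) - (f x - f y)\<bar> \<le> e * dist x y"
proof -
  \<comment> \<open>Each \<open>g\<close> follows \<open>f\<close> at distances at least
    \<open>d\<close> and is nearly flat below some \<open>d'\<close>. Starting the next function at
    \<open>d'\<close> makes the uncontrolled bands, from \<open>d'\<close> up to \<open>d\<close>,
    disjoint.\<close>
  have "\<exists>g d'. g \<in> lipball X z C \<and> little_lip X g \<and> 0 < d' \<and> d' \<le> d \<and>
      (\<forall>x\<in>X. \<forall>y\<in>X. dist x y \<ge> d \<longrightarrow> \<bar>(g x - g y) - (f x - f y)\<bar> \<le> e * dist x y) \<and>
      (\<forall>x\<in>X. \<forall>y\<in>X. dist x y < d' \<longrightarrow> \<bar>g x - g y\<bar> \<le> e * dist x y)" if d: "d > 0" for d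
  proof -
    obtain g where g: "g \<in> lipball X z C" "little_lip X g"
      "\<forall>x\<in>X. \<forall>y\<in>X. dist x y \<ge> d \<longrightarrow> \<bar>(g x - g y) - (f x - f y)\<bar> \<le> e * dist x y"
      using approx[OF d \<open>e > 0\<close>] by blast
    obtain d' where "d' > 0" "\<forall>x\<in>X. \<forall>y\<in>X. dist x y < d' \<longrightarrow> \<bar>g x - g y\<bar> \<le> e * dist x y"
      using g(2) \<open>e > 0\<close> unfolding little_lip_def by blast
    then show ?thesis using g d by (intro exI[of _ g] exI[of _ "min d d'"]) auto
  qed
  then obtain G D where GD: "\<And>d. d > 0 \<Longrightarrow> G d \<in> lipball X z C \<and> little_lip X (G d) \<and> 0 < D d \<and> D d \<le> d \<and>
      (\<forall>x\<in>X. \<forall>y\<in>X. dist x y \<ge> d \<longrightarrow> \<bar>(G d x - G d y) - (f x - f y)\<bar> \<le> e * dist x y) \<and>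
      (\<forall>x\<in>X. \<forall>y\<in>X. dist x y < D d \<longrightarrow> \<bar>G d x - G d y\<bar> \<le> e * dist x y)" by metis
  define \<delta> where "\<delta> k = (D ^^ k) d0" for k
  define g where "g k = G (\<delta> k)" for k
  have pos: "\<delta> k > 0" for k
    by (induction k) (use GD \<open>d0 > 0\<close> in \<open>auto simp: \<delta>_def\<close>)
  have S: "\<delta> (Suc k) = D (\<delta> k)" for k by (simp add: \<delta>_def)
  have anti: "\<delta> n \<le> \<delta> m" if "m \<le> n" for m n
    using that by (rule lift_Suc_antimono_le[rotated]) (use GD pos S in auto)
  note g = GD[OF pos, folded g_def, folded S]
  show thesis
  proof (rule that)
    show "g k \<in> lipball X z C" "little_lip X (g k)" for k using g by auto
    show "\<bar>(g k x - g k y) - (f x - f y)\<bar> \<le> e * dist x y" if "x \<in> X" "y \<in> X" "dist x y \<ge> d0" for k x y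
    proof -
      have "\<delta> k \<le> d0" using anti[of 0 k] by (simp add: \<delta>_def)
      then show ?thesis using g[of k] that by auto
    qed
    show "\<exists>j. \<forall>k. k \<noteq> j \<longrightarrow>
        \<bar>g k x - g k y\<bar> \<le> e * dist x y \<or> \<bar>(g k x - g k y) - (f x - f y)\<bar> \<le> e * dist x y"
      if xy: "x \<in> X" "y \<in> X" for x y
    proof -
      \<comment> \<open>Functions before \<open>j\<close> are nearly flat at this distance, those
        after it are close to \<open>f\<close>. If no \<open>k\<close> qualifies, then whatever
        \<open>LEAST\<close> returns, all of them are nearly flat there.\<close>
      define j where "j = (LEAST k. \<delta> (Suc k) \<le> dist x y)"
      have "\<delta> k \<le> dist x y \<or> dist x y < \<delta> (Suc k)" if "k \<noteq> j" for k
      proof (cases "\<delta> (Suc k) \<le> dist x y")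
        case True
        then have "\<delta> (Suc j) \<le> dist x y" "j \<le> k" unfolding j_def by (auto intro: LeastI Least_le)
        then show ?thesis using anti[of "Suc j" k] \<open>k \<noteq> j\<close> by force
      qed auto
      then show ?thesis using g xy by blast
    qed
  qed
qed

text \<open>Isolates the exceptional index of the gliding hump: its excess \<open>c\<close> enters
  once, hence as \<open>c / N\<close> in an average.\<close>

lemma sum_le_all_but_one:
  fixes v :: "nat \<Rightarrow> real"
  assumes "\<And>k. k \<noteq> j \<Longrightarrow> v k \<le> b" "v j \<le> b + c" "c \<ge> 0"
  shows "(\<Sum>k<N. v k) \<le> N * b + c"
proof -
  have "(\<Sum>k<N. v k) \<le> (\<Sum>k<N. b + (if k = j then c else 0))"
    using assms by (intro sum_mono) auto
  also have "\<dots> = N * b + (if j < N then c else 0)" by (simp add: sum.distrib sum.delta)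
  also have "\<dots> \<le> N * b + c" using \<open>c \<ge> 0\<close> by simp
  finally show ?thesis .
qed

section \<open>Interpolation at a sequence of pairs; compactness of balls\<close>

locale pointed_pairs =
  fixes X :: "'a::metric_space set" and z :: 'a and xs ys :: "nat \<Rightarrow> 'a"
  assumes zX: "z \<in> X" and xsX: "\<And>n. xs n \<in> X" and ysX: "\<And>n. ys n \<in> X"
    and neq: "\<And>n. xs n \<noteq> ys n"
begin

lemma lipnorm_le_iff: "f \<in> Lip0 X z \<and> lipnorm X f \<le> K \<longleftrightarrow> f \<in> lipball X z K"
  using Lip0_lipnorm_le_iff[OF xsX ysX neq] .

lemma interp_op_scale: "interp_op xs ys (\<lambda>x. c * f x) = (\<lambda>n. c * interp_op xs ys f n)"
  by (simp add: interp_op_def fun_eq_iff right_diff_distrib)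

lemma interp_op_le: "f \<in> lipball X z K \<Longrightarrow> \<bar>interp_op xs ys f n\<bar> \<le> K"
  using neq xsX ysX by (auto simp: interp_op_def lipball_def divide_le_eq)

lemma lipball_nonneg: "f \<in> lipball X z K \<Longrightarrow> K \<ge> 0"
  using interp_op_le[of f K 0] by linarith

lemma continuous_on_interp_op: "continuous_on UNIV (\<lambda>f. interp_op xs ys f n)"
  unfolding interp_op_def by (intro continuous_intros) (use neq in auto)

lemma interp_op_cong: "(\<And>x. x \<in> X \<Longrightarrow> f x = g x) \<Longrightarrow> interp_op xs ys f = interp_op xs ys g"
  using xsX ysX by (simp add: interp_op_def fun_eq_iff)

text \<open>In the product topology, the ball is compact once the irrelevant values outside \<open>X\<close> are
  normalised to zero.\<close>

definition nball :: "real \<Rightarrow> ('a \<Rightarrow> real) set" where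
  "nball K = lipball X z K \<inter> {f. \<forall>x. x \<notin> X \<longrightarrow> f x = 0}"

lemma lipball_normalise:
  assumes "f \<in> lipball X z K"
  shows "\<exists>g\<in>nball K. interp_op xs ys g = interp_op xs ys f"
proof (intro bexI)
  show "interp_op xs ys (\<lambda>x. if x \<in> X then f x else 0) = interp_op xs ys f"
    by (intro interp_op_cong) auto
  show "(\<lambda>x. if x \<in> X then f x else 0) \<in> nball K"
    using assms zX by (auto simp: nball_def lipball_def)
qed

text \<open>Tychonoff's theorem: as \<open>f z = 0\<close>, each \<open>f x\<close> lies in a fixed
  compact interval, and each condition defining the ball involves at most two values, hence is
  closed.\<close>

lemma compact_nball: "compact (nball K)"
proof -
  let ?P = "PiE UNIV (\<lambda>x. {- \<bar>K * dist x z\<bar> .. \<bar>K * dist x z\<bar>})"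
  have "compactin (product_topology (\<lambda>_. euclidean) UNIV) ?P"
    by (subst compactin_PiE) auto
  then have P: "compact ?P" by (simp add: euclidean_product_topology)
  have cl: "closed (nball K)"
  proof -
    have "nball K = {f. f z = 0} \<inter> (\<Inter>x\<in>X. \<Inter>y\<in>X. {f. \<bar>f x - f y\<bar> \<le> K * dist x y})
        \<inter> (\<Inter>x\<in>-X. {f. f x = 0})"
      by (auto simp: nball_def lipball_def)
    also have "closed \<dots>"
      by (intro closed_Int closed_INT ballI closed_Collect_le closed_Collect_eq continuous_intros) auto
    finally show ?thesis .
  qed
  have "nball K \<subseteq> ?P"
  proof
    fix f assume f: "f \<in> nball K"
    have "\<bar>f x\<bar> \<le> \<bar>K * dist x z\<bar>" for x
    proof (cases "x \<in> X")
      case True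
      have fb: "f \<in> lipball X z K" using f by (simp add: nball_def)
      show ?thesis using lipballD(2)[OF fb True zX] lipballD(1)[OF fb] by simp
    qed (use f in \<open>auto simp: nball_def\<close>)
    then show "f \<in> ?P" by (auto simp: abs_le_iff minus_le_iff)
  qed
  then show ?thesis using compact_Int_closed[OF P cl] by (simp add: Int_absorb1)
qed

text \<open>Finite intersection property: each equation involves two values of \<open>f\<close>
  only, so it defines a closed set.\<close>

lemma interpolation_by_compactness:
  assumes "\<And>N. \<exists>f\<in>lipball X z K. \<forall>n<N. interp_op xs ys f n = \<alpha> n"
  shows "\<exists>f\<in>lipball X z K. interp_op xs ys f = \<alpha>"
proof -
  have "nball K \<inter> (\<Inter>n\<in>UNIV. {f. interp_op xs ys f n = \<alpha> n}) \<noteq> {}"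
  proof (rule compact_imp_fip_image[OF compact_nball])
    show "closed {f. interp_op xs ys f n = \<alpha> n}" for n
      by (intro closed_Collect_eq continuous_on_interp_op continuous_intros)
    fix I :: "nat set" assume "finite I"
    then obtain N where N: "\<forall>n\<in>I. n < N" using finite_nat_set_iff_bounded by blast
    obtain f where "f \<in> lipball X z K" "\<forall>n<N. interp_op xs ys f n = \<alpha> n" using assms by blast
    moreover obtain g where "g \<in> nball K" "interp_op xs ys g = interp_op xs ys f"
      using lipball_normalise[OF \<open>f \<in> lipball X z K\<close>] by blast
    ultimately have "g \<in> nball K \<inter> (\<Inter>n\<in>I. {f. interp_op xs ys f n = \<alpha> n})" using N by auto
    then show "nball K \<inter> (\<Inter>n\<in>I. {f. interp_op xs ys f n = \<alpha> n}) \<noteq> {}" by blast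
  qed
  then show ?thesis by (auto simp: nball_def)
qed

section \<open>The operator \<open>S\<close> and the dual norm\<close>

lemma Sop_abs_le:
  assumes "lam \<in> l1" "f \<in> lipball X z K"
  shows "\<bar>Sop xs ys lam f\<bar> \<le> K * l1norm lam" "summable (\<lambda>n. lam n * interp_op xs ys f n)"
proof -
  have s: "summable (\<lambda>n. K * \<bar>lam n\<bar>)" using assms by (simp add: l1_def summable_mult)
  have le: "\<bar>lam n * interp_op xs ys f n\<bar> \<le> K * \<bar>lam n\<bar>" for n
    using interp_op_le[OF assms(2), of n] mult_right_mono[OF _ abs_ge_zero, of _ K "lam n"]
    by (simp add: abs_mult mult.commute[of "\<bar>lam n\<bar>"])
  have sa: "summable (\<lambda>n. \<bar>lam n * interp_op xs ys f n\<bar>)"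
    by (rule summable_comparison_test'[OF s]) (use le in auto)
  show "summable (\<lambda>n. lam n * interp_op xs ys f n)" by (rule summable_rabs_cancel[OF sa])
  have "\<bar>Sop xs ys lam f\<bar> \<le> (\<Sum>n. \<bar>lam n * interp_op xs ys f n\<bar>)"
    unfolding Sop_def by (rule summable_rabs[OF sa])
  also have "\<dots> \<le> (\<Sum>n. K * \<bar>lam n\<bar>)" by (rule suminf_le[OF le sa s])
  also have "\<dots> = K * l1norm lam" unfolding l1norm_def using assms by (simp add: l1_def suminf_mult)
  finally show "\<bar>Sop xs ys lam f\<bar> \<le> K * l1norm lam" .
qed

lemma dual_norm_eq: "dual_norm X z \<phi> = (SUP f\<in>lipball X z 1. \<bar>\<phi> f\<bar>)"
  unfolding dual_norm_def using lipnorm_le_iff[of _ 1] by (intro arg_cong[of _ _ Sup]) auto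

lemma zero_in_lipball: "K \<ge> 0 \<Longrightarrow> (\<lambda>_. 0) \<in> lipball X z K"
  by (simp add: lipball_def)

lemma dual_norm_Sop_le: "lam \<in> l1 \<Longrightarrow> dual_norm X z (Sop xs ys lam) \<le> l1norm lam"
  unfolding dual_norm_eq using zero_in_lipball[of 1] Sop_abs_le(1)[of lam _ 1]
  by (intro cSUP_least) auto

lemma Sop_le_dual_norm:
  assumes "lam \<in> l1" "f \<in> lipball X z K" "K > 0"
  shows "\<bar>Sop xs ys lam f\<bar> \<le> K * dual_norm X z (Sop xs ys lam)"
proof -
  let ?g = "\<lambda>x. (1 / K) * f x"
  have g: "?g \<in> lipball X z 1" using assms by (intro lipball_scale[OF assms(2)]) auto
  have "\<bar>Sop xs ys lam ?g\<bar> \<le> dual_norm X z (Sop xs ys lam)"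
    unfolding dual_norm_eq
    by (intro cSUP_upper[OF g] bdd_aboveI[of _ "l1norm lam"]) (use Sop_abs_le(1)[OF assms(1), of _ 1] in auto)
  moreover have "Sop xs ys lam ?g = (1 / K) * Sop xs ys lam f"
    unfolding interp_op_scale Sop_def using Sop_abs_le(2)[OF assms(1,2)]
    by (subst suminf_mult[symmetric]) (auto simp: mult_ac)
  ultimately have "\<bar>(1 / K) * Sop xs ys lam f\<bar> \<le> dual_norm X z (Sop xs ys lam)" by metis
  then show ?thesis using \<open>K > 0\<close> by (simp add: abs_mult field_simps)
qed

text \<open>The ball is symmetric, so a one-sided bound controls absolute values; minimality
  arguments supply just such a bound.\<close>

lemma dual_norm_Sop_least:
  assumes "\<And>f. f \<in> lipball X z K \<Longrightarrow> Sop xs ys lam f \<le> B" "K > 0" "lam \<in> l1"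
  shows "K * dual_norm X z (Sop xs ys lam) \<le> B"
proof -
  have "\<bar>Sop xs ys lam f\<bar> \<le> B / K" if f: "f \<in> lipball X z 1" for f
  proof -
    have *: "Sop xs ys lam (\<lambda>x. c * f x) = c * Sop xs ys lam f" for c
      unfolding interp_op_scale Sop_def using Sop_abs_le(2)[OF assms(3) f]
      by (subst suminf_mult[symmetric]) (auto simp: mult_ac)
    have "(\<lambda>x. K * f x) \<in> lipball X z K" using f assms(2) by (intro lipball_scale) auto
    moreover from this have "(\<lambda>x. (- K) * f x) \<in> lipball X z K"
      by (auto simp: lipball_def abs_minus_commute)
    ultimately have "K * Sop xs ys lam f \<le> B" "(- K) * Sop xs ys lam f \<le> B"
      using assms(1) * by metis+
    then show ?thesis using \<open>K > 0\<close> by (auto simp: field_simps abs_le_iff)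
  qed
  then have "dual_norm X z (Sop xs ys lam) \<le> B / K"
    unfolding dual_norm_eq using zero_in_lipball[of 1] by (intro cSUP_least) auto
  then show ?thesis using \<open>K > 0\<close> by (simp add: field_simps)
qed

text \<open>A least-squares approximation \<open>f\<close> of \<open>\<alpha>\<close> within the ball is exact: by minimality, the residual
  \<open>\<lambda>\<close> satisfies \<open>K \<parallel>S \<lambda>\<parallel> \<le> \<langle>\<lambda>, T f\<rangle> = \<langle>\<lambda>, \<alpha>\<rangle> - \<parallel>\<lambda>\<parallel>\<^sub>2\<^sup>2\<close>, whereas \<open>\<langle>\<lambda>, \<alpha>\<rangle> \<le> \<parallel>\<lambda>\<parallel>\<^sub>1 \<le> K \<parallel>S \<lambda>\<parallel>\<close>.\<close>

lemma finite_interpolation_of_lower_bound: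
  assumes low: "\<And>lam. lam \<in> l1 \<Longrightarrow> l1norm lam \<le> K * dual_norm X z (Sop xs ys lam)"
    and "K > 0" and \<alpha>: "\<And>n. \<bar>\<alpha> n\<bar> \<le> 1"
  shows "\<exists>f\<in>lipball X z K. \<forall>n<N. interp_op xs ys f n = \<alpha> n"
proof -
  let ?T = "interp_op xs ys"
  define Q where "Q f = (\<Sum>n<N. (\<alpha> n - ?T f n)\<^sup>2)" for f
  have "continuous_on (nball K) Q" unfolding Q_def
    by (intro continuous_intros continuous_on_subset[OF continuous_on_interp_op]) auto
  moreover have "(\<lambda>_. 0) \<in> nball K" using zero_in_lipball[of K] \<open>K > 0\<close> by (simp add: nball_def)
  ultimately obtain f where f: "f \<in> nball K" "\<forall>g\<in>nball K. Q f \<le> Q g"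
    using continuous_attains_inf[OF compact_nball, of K Q] by blast
  have fb: "f \<in> lipball X z K" using f by (simp add: nball_def)
  have fmin: "Q f \<le> Q g" if "g \<in> lipball X z K" for g
    using f(2) lipball_normalise[OF that] unfolding Q_def by metis
  define lam where "lam n = (if n < N then \<alpha> n - ?T f n else 0)" for n
  have lam: "lam \<in> l1" by (auto simp: l1_def lam_def split: if_splits intro!: summable_finite[of "{..<N}"])
  have Sop: "Sop xs ys lam g = (\<Sum>n<N. lam n * ?T g n)" for g
    unfolding Sop_def by (rule suminf_finite) (auto simp: lam_def)
  have "Sop xs ys lam g \<le> Sop xs ys lam f" if g: "g \<in> lipball X z K" for g
  proof (rule ccontr)
    define b where "b = Sop xs ys lam g - Sop xs ys lam f"
    define c where "c = (\<Sum>n<N. (?T g n - ?T f n)\<^sup>2)"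
    assume "\<not> ?thesis"
    then have "b > 0" by (simp add: b_def)
    have "c \<ge> 0" by (simp add: c_def sum_nonneg)
    \<comment> \<open>Moving from \<open>f\<close> towards \<open>g\<close> by \<open>t\<close>
      changes \<open>Q\<close> by \<open>- 2 * t * b + t\<^sup>2 * c\<close>, which minimality makes
      nonnegative.\<close>
    have key: "2 * b \<le> t * c" if t: "0 < t" "t \<le> 1" for t
    proof -
      define h where "h x = (1 - t) * f x + t * g x" for x
      have h: "h \<in> lipball X z K"
      proof (rule lipballI)
        show "h z = 0" using lipballD(1)[OF fb] lipballD(1)[OF g] by (simp add: h_def)
        fix x y assume xy: "x \<in> X" "y \<in> X"
        have "h x - h y = (1 - t) * (f x - f y) + t * (g x - g y)" by (simp add: h_def algebra_simps)
        then have "\<bar>h x - h y\<bar> \<le> (1 - t) * \<bar>f x - f y\<bar> + t * \<bar>g x - g y\<bar>"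
          using abs_triangle_ineq[of "(1 - t) * (f x - f y)" "t * (g x - g y)"] t by (simp add: abs_mult)
        also have "\<dots> \<le> (1 - t) * (K * dist x y) + t * (K * dist x y)"
          using lipballD(2)[OF fb xy] lipballD(2)[OF g xy] t by (intro add_mono mult_left_mono) auto
        finally show "\<bar>h x - h y\<bar> \<le> K * dist x y" by (simp add: algebra_simps)
      qed
      have Th: "?T h n = ?T f n + t * (?T g n - ?T f n)" for n
        using neq[of n] by (simp add: interp_op_def h_def field_simps)
      have "Q h = (\<Sum>n<N. (\<alpha> n - ?T f n)\<^sup>2 - 2 * t * (lam n * ?T g n - lam n * ?T f n) + t\<^sup>2 * (?T g n - ?T f n)\<^sup>2)"
        unfolding Q_def by (intro sum.cong) (auto simp: lam_def Th power2_eq_square algebra_simps)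
      also have "\<dots> = Q f - 2 * t * b + t\<^sup>2 * c"
        by (simp add: sum.distrib sum_subtractf Q_def b_def c_def Sop flip: sum_distrib_left)
      finally have "2 * t * b \<le> t\<^sup>2 * c" using fmin[OF h] by linarith
      then have "t * (2 * b) \<le> t * (t * c)" by (simp add: power2_eq_square mult_ac)
      then show ?thesis using t by (simp only: mult_le_cancel_left_pos)
    qed
    \<comment> \<open>At \<open>t = b / (b + c)\<close>, which is positive and at most 1 even when
      \<open>c = 0\<close>, \<open>t * c\<close> is at most \<open>b\<close>, contradicting
      \<open>2 * b \<le> t * c\<close>.\<close>
    have "b / (b + c) * c \<le> b" using \<open>b > 0\<close> \<open>c \<ge> 0\<close> by (simp add: field_simps)
    moreover have "2 * b \<le> b / (b + c) * c" using \<open>b > 0\<close> \<open>c \<ge> 0\<close> by (intro key) auto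
    ultimately show False using \<open>b > 0\<close> by linarith
  qed
  then have "K * dual_norm X z (Sop xs ys lam) \<le> Sop xs ys lam f"
    by (rule dual_norm_Sop_least) (use lam \<open>K > 0\<close> in auto)
  then have 1: "l1norm lam \<le> Sop xs ys lam f" using low[OF lam] by linarith
  have "l1norm lam = (\<Sum>n<N. \<bar>lam n\<bar>)"
    unfolding l1norm_def by (rule suminf_finite) (auto simp: lam_def)
  moreover have "(\<Sum>n<N. lam n * \<alpha> n) \<le> (\<Sum>n<N. \<bar>lam n\<bar>)"
  proof (rule sum_mono)
    fix n
    have "lam n * \<alpha> n \<le> \<bar>lam n\<bar> * \<bar>\<alpha> n\<bar>" by (simp flip: abs_mult)
    also have "\<dots> \<le> \<bar>lam n\<bar>" using \<alpha>[of n] by (simp add: mult_left_le)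
    finally show "lam n * \<alpha> n \<le> \<bar>lam n\<bar>" .
  qed
  moreover have "(\<Sum>n<N. lam n * \<alpha> n) = Sop xs ys lam f + Q f"
    unfolding Sop Q_def by (simp add: lam_def power2_eq_square algebra_simps flip: sum.distrib)
  ultimately have "Q f \<le> 0" using 1 by linarith
  moreover have "Q f \<ge> 0" unfolding Q_def by (simp add: sum_nonneg)
  ultimately have "Q f = 0" by linarith
  then have "\<forall>n<N. (\<alpha> n - ?T f n)\<^sup>2 = 0"
    unfolding Q_def by (subst (asm) sum_nonneg_eq_0_iff) auto
  then show ?thesis using fb by (intro bexI[of _ f]) auto
qed

section \<open>Admissible constants for the two spaces of data\<close>

lemma c0_constants_Lip0_iff:
  "K \<in> c0_interp_constants X (Lip0 X z) xs ys \<longleftrightarrow> K > 0 \<and>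
     (\<forall>\<alpha>\<in>c0. (\<forall>n. \<bar>\<alpha> n\<bar> \<le> 1) \<longrightarrow> (\<exists>f\<in>lipball X z K. interp_op xs ys f = \<alpha>))"
  using lipnorm_le_iff unfolding c0_interp_constants_def by blast

lemma c0_constants_lip0_iff:
  "K \<in> c0_interp_constants X (lip0 X z) xs ys \<longleftrightarrow> K > 0 \<and>
     (\<forall>\<alpha>\<in>c0. (\<forall>n. \<bar>\<alpha> n\<bar> \<le> 1) \<longrightarrow> (\<exists>f\<in>lipball X z K. little_lip X f \<and> interp_op xs ys f = \<alpha>))"
  using lipnorm_le_iff lip0_iff[of _ X z] unfolding c0_interp_constants_def by blast

lemma Lip_constants_iff:
  "K \<in> Lip_interp_constants X z xs ys \<longleftrightarrow> K \<ge> 1 \<and>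
     (\<forall>\<alpha>\<in>linfty. (\<forall>n. \<bar>\<alpha> n\<bar> \<le> 1) \<longrightarrow> (\<exists>f\<in>lipball X z K. interp_op xs ys f = \<alpha>))"
  using lipnorm_le_iff unfolding Lip_interp_constants_def by blast

lemma c0_subset_linfty: "c0 \<subseteq> linfty"
  unfolding c0_def linfty_def using convergent_imp_bounded convergentI by blast

lemma finite_support_c0: "(\<And>n. n \<ge> N \<Longrightarrow> \<alpha> n = 0) \<Longrightarrow> \<alpha> \<in> c0"
  unfolding c0_def by (auto intro!: tendsto_eventually eventually_sequentiallyI)

text \<open>Interpolating the first unit vector forces a quotient equal to 1. This reconciles
  \<open>K \<ge> 1\<close> in (i) with \<open>K > 0\<close> in (iv).\<close>

lemma c0_constant_ge_1:
  assumes "K \<in> c0_interp_constants X (Lip0 X z) xs ys"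
  shows "K \<ge> 1"
proof -
  define \<alpha> :: "nat \<Rightarrow> real" where "\<alpha> n = (if n = 0 then 1 else 0)" for n
  have "\<alpha> \<in> c0" by (rule finite_support_c0[of 1]) (simp add: \<alpha>_def)
  moreover have "\<forall>n. \<bar>\<alpha> n\<bar> \<le> 1" by (simp add: \<alpha>_def)
  ultimately obtain f where f: "f \<in> lipball X z K" "interp_op xs ys f = \<alpha>"
    using assms unfolding c0_constants_Lip0_iff by blast
  show ?thesis using interp_op_le[OF f(1), of 0] f(2) by (simp add: \<alpha>_def)
qed

text \<open>Testing \<open>Sop xs ys lam\<close> on a function that interpolates the signs of the
  first \<open>N\<close> coordinates returns a partial sum of \<open>l1norm lam\<close>; truncation
  puts the data in \<open>c0\<close>.\<close>

lemma c0_constant_lower_bound: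
  assumes "K \<in> c0_interp_constants X (Lip0 X z) xs ys" "lam \<in> l1"
  shows "l1norm lam \<le> K * dual_norm X z (Sop xs ys lam)"
  unfolding l1norm_def
proof (rule suminf_le_const)
  show "summable (\<lambda>n. \<bar>lam n\<bar>)" using assms by (simp add: l1_def)
  fix N
  define \<alpha> where "\<alpha> n = (if n < N then sgn (lam n) else 0)" for n
  have "\<alpha> \<in> c0" by (rule finite_support_c0[of N]) (simp add: \<alpha>_def)
  moreover have "\<forall>n. \<bar>\<alpha> n\<bar> \<le> 1" by (simp add: \<alpha>_def abs_sgn_eq)
  ultimately obtain f where f: "f \<in> lipball X z K" "interp_op xs ys f = \<alpha>"
    using assms unfolding c0_constants_Lip0_iff by blast
  have "Sop xs ys lam f = (\<Sum>n<N. lam n * \<alpha> n)"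
    unfolding Sop_def f(2) by (rule suminf_finite) (auto simp: \<alpha>_def)
  also have "\<dots> = (\<Sum>n<N. \<bar>lam n\<bar>)"
    by (intro sum.cong) (auto simp: \<alpha>_def mult_sgn_abs abs_sgn)
  finally show "(\<Sum>n<N. \<bar>lam n\<bar>) \<le> K * dual_norm X z (Sop xs ys lam)"
    using Sop_le_dual_norm[OF assms(2) f(1)] assms(1) unfolding c0_constants_Lip0_iff by auto
qed

lemma interpolation_of_lower_bound:
  assumes "\<And>lam. lam \<in> l1 \<Longrightarrow> l1norm lam \<le> K * dual_norm X z (Sop xs ys lam)"
    and "K > 0" "\<And>n. \<bar>\<alpha> n\<bar> \<le> 1"
  shows "\<exists>f\<in>lipball X z K. interp_op xs ys f = \<alpha>"
  using finite_interpolation_of_lower_bound[OF assms] by (rule interpolation_by_compactness)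

lemma c0_constants_iff_lower_bound:
  "K \<in> c0_interp_constants X (Lip0 X z) xs ys \<longleftrightarrow>
     K > 0 \<and> (\<forall>lam\<in>l1. l1norm lam \<le> K * dual_norm X z (Sop xs ys lam))"
  using c0_constant_lower_bound interpolation_of_lower_bound c0_constants_Lip0_iff by meson

text \<open>The lower bound for \<open>S\<close> does not remember the data it came from, so passing
  through it upgrades null data to all data bounded by 1.\<close>

lemma c0_constant_interpolation:
  assumes "K \<in> c0_interp_constants X (Lip0 X z) xs ys" "\<And>n. \<bar>\<alpha> n\<bar> \<le> 1"
  shows "\<exists>f\<in>lipball X z K. interp_op xs ys f = \<alpha>"
  using assms interpolation_of_lower_bound unfolding c0_constants_iff_lower_bound by blast

lemma Lip_constants_eq_c0_constants:
  "Lip_interp_constants X z xs ys = c0_interp_constants X (Lip0 X z) xs ys"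
proof (intro set_eqI iffI)
  fix K assume "K \<in> Lip_interp_constants X z xs ys"
  then show "K \<in> c0_interp_constants X (Lip0 X z) xs ys"
    unfolding Lip_constants_iff c0_constants_Lip0_iff using c0_subset_linfty by fastforce
next
  fix K assume "K \<in> c0_interp_constants X (Lip0 X z) xs ys"
  then show "K \<in> Lip_interp_constants X z xs ys"
    unfolding Lip_constants_iff using c0_constant_interpolation c0_constant_ge_1 by blast
qed

lemma lower_constants_iff:
  "J \<in> Sop_lower_constants X z xs ys \<longleftrightarrow> J > 0 \<and> 1 / J \<in> c0_interp_constants X (Lip0 X z) xs ys"
  unfolding c0_constants_iff_lower_bound Sop_lower_constants_def
  by (auto simp: field_simps)

text \<open>For fixed \<open>lam\<close> the lower-bound inequality is closed in \<open>K\<close>,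
  so it survives the passage to the infimum.\<close>

lemma Inf_c0_constants_mem:
  assumes "c0_interp_constants X (Lip0 X z) xs ys \<noteq> {}"
  shows "Inf (c0_interp_constants X (Lip0 X z) xs ys) \<in> c0_interp_constants X (Lip0 X z) xs ys"
proof -
  let ?S = "c0_interp_constants X (Lip0 X z) xs ys"
  have ge: "Inf ?S \<ge> 1" using assms c0_constant_ge_1 by (intro cInf_greatest)
  have "l1norm lam \<le> Inf ?S * dual_norm X z (Sop xs ys lam)" if lam: "lam \<in> l1" for lam
  proof (cases "dual_norm X z (Sop xs ys lam) > 0")
    case True
    have "l1norm lam / dual_norm X z (Sop xs ys lam) \<le> Inf ?S"
      using assms True c0_constant_lower_bound lam by (intro cInf_greatest) (auto simp: field_simps)
    then show ?thesis using True by (simp add: field_simps)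
  next
    case False
    obtain K where K: "K \<in> ?S" using assms by blast
    have "\<bar>Sop xs ys lam (\<lambda>_. 0)\<bar> \<le> 1 * dual_norm X z (Sop xs ys lam)"
      by (rule Sop_le_dual_norm[OF lam zero_in_lipball]) auto
    then have "dual_norm X z (Sop xs ys lam) = 0" using False by linarith
    then show ?thesis using c0_constant_lower_bound[OF K lam] by simp
  qed
  then show ?thesis using ge unfolding c0_constants_iff_lower_bound by auto
qed

section \<open>Null data and little Lipschitz functions\<close>

text \<open>Otherwise compactness makes a subsequence of the pairs converge to a pair of distinct
  points. Along it \<open>interp_op xs ys f\<close> converges for every Lipschitz \<open>f\<close>,
  so alternating data cannot be interpolated.\<close>

lemma pair_dist_tendsto_0:
  assumes "compact X" and K: "K \<in> c0_interp_constants X (Lip0 X z) xs ys"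
  shows "(\<lambda>n. dist (xs n) (ys n)) \<longlonglongrightarrow> 0"
proof (rule ccontr)
  assume "\<not> ?thesis"
  then obtain e where e: "e > 0" "\<forall>N. \<exists>n\<ge>N. dist (xs n) (ys n) \<ge> e"
    unfolding lim_sequentially by (auto simp: dist_real_def not_less)
  define S where "S = {n. dist (xs n) (ys n) \<ge> e}"
  have "infinite S" unfolding infinite_nat_iff_unbounded_le S_def using e(2) by auto
  then have r0: "strict_mono (enumerate S)" "\<And>k. enumerate S k \<in> S"
    by (auto simp: strict_mono_enumerate enumerate_in_set)
  have "seq_compact (X \<times> X)" using assms(1) by (simp add: compact_Times compact_imp_seq_compact)
  then obtain l r1 where l: "l \<in> X \<times> X" "strict_mono r1"
      "((\<lambda>k. (xs (enumerate S k), ys (enumerate S k))) \<circ> r1) \<longlonglongrightarrow> l"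
    by (rule seq_compactE[where f = "\<lambda>k. (xs (enumerate S k), ys (enumerate S k))"]) (use xsX ysX in auto)
  define r where "r = enumerate S \<circ> r1"
  define x y where "x = fst l" and "y = snd l"
  have r: "strict_mono r" unfolding r_def using r0(1) l(2) by (rule strict_mono_o)
  have x: "(\<lambda>k. xs (r k)) \<longlonglongrightarrow> x" and y: "(\<lambda>k. ys (r k)) \<longlonglongrightarrow> y"
    using tendsto_fst[OF l(3)] tendsto_snd[OF l(3)] by (simp_all add: r_def x_def y_def comp_def)
  have X: "x \<in> X" "y \<in> X" using l(1) by (auto simp: x_def y_def)
  have d: "(\<lambda>k. dist (xs (r k)) (ys (r k))) \<longlonglongrightarrow> dist x y" using x y by (rule tendsto_dist)
  have "e \<le> dist x y"
    by (rule LIMSEQ_le_const[OF d]) (use r0(2) in \<open>auto simp: r_def S_def\<close>)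
  then have "dist x y \<noteq> 0" using e by auto
  \<comment> \<open>The data are 1 at even and 0 at odd places of the subsequence, hence not null;
    \<open>c0_constant_interpolation\<close> asks only for the bound 1.\<close>
  define \<alpha> :: "nat \<Rightarrow> real" where "\<alpha> n = (if n \<in> range (\<lambda>k. r (2 * k)) then 1 else 0)" for n
  have "\<bar>\<alpha> n\<bar> \<le> 1" for n by (simp add: \<alpha>_def)
  then obtain f where f: "f \<in> lipball X z K" "interp_op xs ys f = \<alpha>"
    using c0_constant_interpolation[OF K, of \<alpha>] by blast
  have cont: "(\<lambda>k. f (u k)) \<longlonglongrightarrow> f v" if "u \<longlonglongrightarrow> v" "\<And>k. u k \<in> X" "v \<in> X" for u v
  proof (rule Lim_null_comparison[THEN LIM_zero_cancel])
    show "\<forall>\<^sub>F k in sequentially. norm (f (u k) - f v) \<le> K * dist (u k) v"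
      using lipballD(2)[OF f(1)] that by simp
    have "(\<lambda>k. dist (u k) v) \<longlonglongrightarrow> 0" using that(1) by (simp add: tendsto_dist_iff[symmetric])
    then show "(\<lambda>k. K * dist (u k) v) \<longlonglongrightarrow> 0" by (rule tendsto_mult_right_zero)
  qed
  have lim0: "(\<lambda>k. \<alpha> (r k)) \<longlonglongrightarrow> (f x - f y) / dist x y"
    unfolding f(2)[symmetric] interp_op_def
    by (intro tendsto_intros cont x y d xsX ysX X) fact
  have lim: "(\<lambda>k. \<alpha> (r (h k))) \<longlonglongrightarrow> (f x - f y) / dist x y" if "strict_mono h" for h
    using LIMSEQ_subseq_LIMSEQ[OF lim0 that] by (simp add: comp_def)
  have "\<alpha> (r (2 * k)) = 1" for k by (auto simp: \<alpha>_def)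
  then have "(f x - f y) / dist x y = 1"
    using lim[of "\<lambda>k. 2 * k"] by (auto simp: strict_mono_def LIMSEQ_const_iff)
  moreover have "r (Suc (2 * k)) \<noteq> r (2 * i)" for k i
    using strict_mono_eq[OF r, of "Suc (2 * k)" "2 * i"] by presburger
  then have "\<alpha> (r (Suc (2 * k))) = 0" for k by (auto simp: \<alpha>_def)
  then have "(f x - f y) / dist x y = 0"
    using lim[of "\<lambda>k. Suc (2 * k)"] by (simp add: strict_mono_def LIMSEQ_const_iff)
  ultimately show False by simp
qed

text \<open>All but finitely many pairs are so close that flatness makes their quotient small. This
  keeps residuals null in the iteration below.\<close>

lemma interp_op_little_lip_c0:
  assumes "little_lip X g" and d: "(\<lambda>n. dist (xs n) (ys n)) \<longlonglongrightarrow> 0"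
  shows "interp_op xs ys g \<in> c0"
  unfolding c0_def
proof (simp, rule LIMSEQ_I)
  fix e :: real assume "e > 0"
  then obtain \<delta> where \<delta>: "\<delta> > 0" "\<forall>x\<in>X. \<forall>y\<in>X. dist x y < \<delta> \<longrightarrow> \<bar>g x - g y\<bar> \<le> e/2 * dist x y"
    using assms(1) unfolding little_lip_def by (meson half_gt_zero)
  obtain N where N: "\<forall>n\<ge>N. dist (xs n) (ys n) < \<delta>"
    using LIMSEQ_D[OF d \<open>\<delta> > 0\<close>] by auto
  have "norm (interp_op xs ys g n - 0) < e" if "n \<ge> N" for n
  proof -
    have "\<bar>g (xs n) - g (ys n)\<bar> \<le> e/2 * dist (xs n) (ys n)" using \<delta> N that xsX ysX by blast
    then have "\<bar>interp_op xs ys g n\<bar> \<le> e/2"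
      using neq[of n] by (simp add: interp_op_def field_simps)
    then show ?thesis using \<open>e > 0\<close> by simp
  qed
  then show "\<exists>N. \<forall>n\<ge>N. norm (interp_op xs ys g n - 0) < e" by blast
qed

text \<open>Averaging \<open>N\<close> gliding-hump functions divides the one bad increment by
  \<open>N\<close>. Where \<open>f\<close> has a small quotient, nearly flat functions also
  approximate it; the finitely many other pairs lie at distances where every \<open>g k\<close> is
  close to \<open>f\<close>.\<close>

lemma approx_interpolation_little_lip:
  assumes "compact X"
    and sep: "\<And>x y. x \<in> X \<Longrightarrow> y \<in> X \<Longrightarrow>
      \<exists>h\<in>lipball X z a. little_lip X h \<and> \<bar>h x - h y\<bar> = dist x y"
    and f: "f \<in> lipball X z K" and "interp_op xs ys f \<in> c0" and "a \<ge> 0" "\<eta> > 0"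
  shows "\<exists>g\<in>lipball X z (K + \<eta>). little_lip X g \<and>
     (\<forall>n. \<bar>interp_op xs ys g n - interp_op xs ys f n\<bar> \<le> \<eta>)"
proof -
  have K: "K \<ge> 0" using lipball_nonneg[OF f] .
  define C where "C = K * a"
  have C: "C \<ge> 0" using K \<open>a \<ge> 0\<close> by (simp add: C_def)
  \<comment> \<open>The norm will exceed \<open>K\<close> by at most \<open>3 * e\<close>, and the
    data will be missed by at most \<open>4 * e\<close>.\<close>
  define e where "e = \<eta> / 4"
  have "e > 0" using \<open>\<eta> > 0\<close> by (simp add: e_def)
  obtain n0 where n0: "\<And>n. n \<ge> n0 \<Longrightarrow> \<bar>interp_op xs ys f n\<bar> < e"
    using LIMSEQ_D[OF _ \<open>e > 0\<close>, of "interp_op xs ys f" 0] assms(4) by (auto simp: c0_def)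
  \<comment> \<open>A pair closer than \<open>d0\<close> has index at least \<open>n0\<close>, hence
    a small quotient of \<open>f\<close>; the 1 keeps the set nonempty when
    \<open>n0 = 0\<close>.\<close>
  define d0 where "d0 = Min (insert 1 ((\<lambda>n. dist (xs n) (ys n)) ` {..<n0}))"
  have "d0 > 0" unfolding d0_def using neq by (subst Min_gr_iff) auto
  have d0: "\<bar>interp_op xs ys f n\<bar> \<le> e" if "dist (xs n) (ys n) < d0" for n
  proof -
    have "d0 \<le> dist (xs n) (ys n)" if "n < n0" unfolding d0_def using that by (intro Min_le) auto
    then show ?thesis using n0[of n] that by fastforce
  qed
  obtain g where g: "\<And>k::nat. g k \<in> lipball X z C" "\<And>k. little_lip X (g k)"
    "\<And>k x y. x \<in> X \<Longrightarrow> y \<in> X \<Longrightarrow> dist x y \<ge> d0 \<Longrightarrow> \<bar>(g k x - g k y) - (f x - f y)\<bar> \<le> e * dist x y"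
    "\<And>x y. x \<in> X \<Longrightarrow> y \<in> X \<Longrightarrow> \<exists>j. \<forall>k. k \<noteq> j \<longrightarrow>
        \<bar>g k x - g k y\<bar> \<le> e * dist x y \<or> \<bar>(g k x - g k y) - (f x - f y)\<bar> \<le> e * dist x y"
    using gliding_hump[OF approx_away_from_diagonal[OF \<open>compact X\<close> zX sep f K \<open>a \<ge> 0\<close>, folded C_def] \<open>d0 > 0\<close> \<open>e > 0\<close>]
    by blast
  \<comment> \<open>For this many functions the exceptional one, with excess at most
    \<open>C + K\<close> per unit of distance, adds at most \<open>2 * e\<close> to the
    average.\<close>
  obtain N :: nat where N: "N > (C + K) / (2 * e)" using reals_Archimedean2 by blast
  then have Npos: "real N > 0" using C K \<open>e > 0\<close> by (smt (verit) divide_nonneg_pos)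
  have N2: "C + K \<le> N * (2 * e)" using N \<open>e > 0\<close> by (simp add: field_simps)
  define G where "G x = (1 / N) * (\<Sum>k<N. g k x)" for x
  have Gdiff: "G x - G y = (\<Sum>k<N. g k x - g k y) / N" for x y
    by (simp add: G_def sum_subtractf diff_divide_distrib)
  have Gdiff': "(G x - G y) - c = (\<Sum>k<N. (g k x - g k y) - c) / N" for x y c
    using Npos by (simp add: Gdiff sum_subtractf diff_divide_distrib)
  have bound: "\<bar>(\<Sum>k<N. v k) / N\<bar> \<le> (b + 2 * e) * D"
    if "\<And>k. k \<noteq> j \<Longrightarrow> \<bar>v k\<bar> \<le> b * D" "\<bar>v j\<bar> \<le> b * D + (C + K) * D" "D \<ge> 0" for v :: "nat \<Rightarrow> real" and b D j
  proof -
    have "\<bar>\<Sum>k<N. v k\<bar> \<le> (\<Sum>k<N. \<bar>v k\<bar>)" by (rule sum_abs)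
    also have "\<dots> \<le> N * (b * D) + (C + K) * D"
      by (rule sum_le_all_but_one[of j]) (use that C K in auto)
    also have "\<dots> \<le> N * (b * D) + N * (2 * e) * D" using N2 that(3) by (simp add: mult_right_mono)
    also have "\<dots> = (b + 2 * e) * D * N" by (simp add: algebra_simps)
    finally show ?thesis using Npos by (simp add: divide_le_eq)
  qed
  have "G \<in> lipball X z (K + \<eta>)"
  proof (rule lipballI)
    show "G z = 0" using lipballD(1)[OF g(1)] by (simp add: G_def)
    fix x y assume xy: "x \<in> X" "y \<in> X"
    obtain j where j: "\<And>k. k \<noteq> j \<Longrightarrow>
        \<bar>g k x - g k y\<bar> \<le> e * dist x y \<or> \<bar>(g k x - g k y) - (f x - f y)\<bar> \<le> e * dist x y"
      using g(4)[OF xy] by blast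
    have fK: "\<bar>f x - f y\<bar> \<le> K * dist x y" and gC: "\<And>k. \<bar>g k x - g k y\<bar> \<le> C * dist x y"
      using lipballD(2)[OF f xy] lipballD(2)[OF g(1) xy] by auto
    have nn: "K * dist x y \<ge> 0" "e * dist x y \<ge> 0" using K \<open>e > 0\<close> by auto
    have "\<bar>(\<Sum>k<N. g k x - g k y) / N\<bar> \<le> ((K + e) + 2 * e) * dist x y"
    proof (rule bound)
      show "\<bar>g k x - g k y\<bar> \<le> (K + e) * dist x y" if "k \<noteq> j" for k
        using j[OF that] fK nn unfolding distrib_right by linarith
      show "\<bar>g j x - g j y\<bar> \<le> (K + e) * dist x y + (C + K) * dist x y"
        using gC[of j] nn unfolding distrib_right by linarith
    qed simp
    also have "\<dots> \<le> (K + \<eta>) * dist x y" using \<open>\<eta> > 0\<close> by (intro mult_right_mono) (auto simp: e_def)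
    finally show "\<bar>G x - G y\<bar> \<le> (K + \<eta>) * dist x y" unfolding Gdiff .
  qed
  moreover have "little_lip X G"
    unfolding G_def by (intro little_lip_scale little_lip_sum g)
  moreover have "\<bar>interp_op xs ys G n - interp_op xs ys f n\<bar> \<le> \<eta>" for n
  proof -
    define x y where "x = xs n" and "y = ys n"
    have xy: "x \<in> X" "y \<in> X" using xsX ysX by (auto simp: x_def y_def)
    have D: "dist x y > 0" using neq by (simp add: x_def y_def)
    obtain j where j: "\<And>k. k \<noteq> j \<Longrightarrow>
        \<bar>g k x - g k y\<bar> \<le> e * dist x y \<or> \<bar>(g k x - g k y) - (f x - f y)\<bar> \<le> e * dist x y"
      using g(4)[OF xy] by blast
    have fK: "\<bar>f x - f y\<bar> \<le> K * dist x y" and gC: "\<And>k. \<bar>g k x - g k y\<bar> \<le> C * dist x y"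
      using lipballD(2)[OF f xy] lipballD(2)[OF g(1) xy] by auto
    have nn: "e * dist x y \<ge> 0" using \<open>e > 0\<close> by auto
    have e2: "2 * e * dist x y = e * dist x y + e * dist x y" by simp
    have "\<bar>(\<Sum>k<N. (g k x - g k y) - (f x - f y)) / N\<bar> \<le> (2 * e + 2 * e) * dist x y"
    proof (rule bound)
      show "\<bar>(g k x - g k y) - (f x - f y)\<bar> \<le> 2 * e * dist x y" if "k \<noteq> j" for k
      proof (cases "dist x y \<ge> d0")
        case True
        then show ?thesis using g(3)[OF xy True, of k] nn e2 by linarith
      next
        case False
        then have "\<bar>f x - f y\<bar> / dist x y \<le> e" using d0[of n] by (simp add: interp_op_def x_def y_def)
        then have "\<bar>f x - f y\<bar> \<le> e * dist x y" using D by (simp add: field_simps)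
        then show ?thesis using j[OF that] nn e2 by linarith
      qed
      show "\<bar>(g j x - g j y) - (f x - f y)\<bar> \<le> 2 * e * dist x y + (C + K) * dist x y"
        using gC[of j] fK nn e2 unfolding distrib_right by linarith
    qed simp
    then have "\<bar>(G x - G y) - (f x - f y)\<bar> \<le> \<eta> * dist x y" unfolding Gdiff' by (simp add: e_def)
    moreover have "interp_op xs ys G n - interp_op xs ys f n = ((G x - G y) - (f x - f y)) / dist x y"
      by (simp add: interp_op_def x_def y_def diff_divide_distrib)
    ultimately show ?thesis using D by (simp add: divide_le_eq)
  qed
  ultimately show ?thesis by blast
qed

text \<open>The successive approximation of the open mapping theorem, with total norm
  \<open>(K + \<eta>) \<Sum> \<eta>^k = L\<close> for the right choice of \<open>\<eta>\<close>.\<close>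

lemma exact_interpolation_little_lip:
  assumes "compact X"
    and sep: "\<And>x y. x \<in> X \<Longrightarrow> y \<in> X \<Longrightarrow>
      \<exists>h\<in>lipball X z a. little_lip X h \<and> \<bar>h x - h y\<bar> = dist x y"
    and "a \<ge> 0" and K: "K \<in> c0_interp_constants X (Lip0 X z) xs ys" and "K < L"
    and \<alpha>: "\<alpha> \<in> c0" "\<And>n. \<bar>\<alpha> n\<bar> \<le> 1"
  shows "\<exists>f\<in>lipball X z L. little_lip X f \<and> interp_op xs ys f = \<alpha>"
proof -
  let ?T = "interp_op xs ys"
  have "K \<ge> 1" using c0_constant_ge_1[OF K] .
  \<comment> \<open>The solution of \<open>K + \<eta> = L * (1 - \<eta>)\<close>, so that the
    geometric series of norms sums to \<open>L\<close>.\<close>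
  define \<eta> where "\<eta> = (L - K) / (1 + L)"
  have \<eta>: "0 < \<eta>" "\<eta> < 1" "K + \<eta> = L * (1 - \<eta>)"
    using \<open>K \<ge> 1\<close> \<open>K < L\<close> by (auto simp: \<eta>_def field_simps)
  have d: "(\<lambda>n. dist (xs n) (ys n)) \<longlonglongrightarrow> 0" using pair_dist_tendsto_0[OF assms(1) K] .
  \<comment> \<open>One correction at level \<open>s\<close>: divide the data by \<open>s\<close>,
    interpolate them in \<open>Lip0\<close>, approximate the result by a little Lipschitz function,
    and multiply back.\<close>
  have "\<exists>g. g \<in> lipball X z (s * (K + \<eta>)) \<and> little_lip X g \<and> (\<forall>n. \<bar>\<beta> n - ?T g n\<bar> \<le> s * \<eta>)"
    if s: "s > 0" and \<beta>: "\<beta> \<in> c0" "\<forall>n. \<bar>\<beta> n\<bar> \<le> s" for s \<beta>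
  proof -
    have "(\<lambda>n. \<beta> n / s) \<longlonglongrightarrow> 0" using \<beta>(1) by (auto simp: c0_def intro: tendsto_divide_zero)
    moreover have "\<bar>\<beta> n / s\<bar> \<le> 1" for n using \<beta>(2) s by (simp add: field_simps)
    then obtain f where f: "f \<in> lipball X z K" "?T f = (\<lambda>n. \<beta> n / s)"
      using c0_constant_interpolation[OF K, of "\<lambda>n. \<beta> n / s"] by blast
    moreover from this have "?T f \<in> c0" using \<open>(\<lambda>n. \<beta> n / s) \<longlonglongrightarrow> 0\<close> by (simp add: c0_def)
    ultimately obtain g where g: "g \<in> lipball X z (K + \<eta>)" "little_lip X g" "\<forall>n. \<bar>?T g n - ?T f n\<bar> \<le> \<eta>"
      using approx_interpolation_little_lip[OF assms(1) sep f(1) _ \<open>a \<ge> 0\<close> \<eta>(1)] by blast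
    have "\<bar>\<beta> n - ?T (\<lambda>x. s * g x) n\<bar> \<le> s * \<eta>" for n
    proof -
      have "\<beta> n - ?T (\<lambda>x. s * g x) n = s * (?T f n - ?T g n)"
        using s by (simp add: interp_op_scale f(2) right_diff_distrib)
      then show ?thesis using g(3) s by (simp add: abs_mult abs_minus_commute)
    qed
    then show ?thesis using lipball_scale[OF g(1) order_refl] little_lip_scale[OF g(2)] s
      by (intro exI[of _ "\<lambda>x. s * g x"]) auto
  qed
  then obtain G where G: "\<And>s \<beta>. s > 0 \<Longrightarrow> \<beta> \<in> c0 \<Longrightarrow> \<forall>n. \<bar>\<beta> n\<bar> \<le> s \<Longrightarrow>
      G s \<beta> \<in> lipball X z (s * (K + \<eta>)) \<and> little_lip X (G s \<beta>) \<and> (\<forall>n. \<bar>\<beta> n - ?T (G s \<beta>) n\<bar> \<le> s * \<eta>)"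
    by metis
  \<comment> \<open>\<open>b k\<close> is what remains of the data after the first \<open>k\<close>
    corrections.\<close>
  define b where "b = rec_nat \<alpha> (\<lambda>k \<beta> n. \<beta> n - ?T (G (\<eta> ^ k) \<beta>) n)"
  define g where "g k = G (\<eta> ^ k) (b k)" for k
  have b0: "b 0 = \<alpha>" and bS: "b (Suc k) = (\<lambda>n. b k n - ?T (g k) n)" for k
    by (simp_all add: b_def g_def)
  have b: "b k \<in> c0 \<and> (\<forall>n. \<bar>b k n\<bar> \<le> \<eta> ^ k)" for k
  proof (induction k)
    case 0
    then show ?case using \<alpha> by (simp add: b0)
  next
    case (Suc k)
    have gk: "little_lip X (g k)" "\<forall>n. \<bar>b k n - ?T (g k) n\<bar> \<le> \<eta> ^ k * \<eta>"
      using G[of "\<eta> ^ k" "b k"] Suc \<eta>(1) by (auto simp: g_def)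
    \<comment> \<open>The residual stays null because the pair distances tend to 0, which makes the
      data of \<open>g k\<close> null.\<close>
    have "(\<lambda>n. b k n - ?T (g k) n) \<longlonglongrightarrow> 0 - 0"
      using Suc interp_op_little_lip_c0[OF gk(1) d] by (intro tendsto_diff) (auto simp: c0_def)
    then show ?case using gk(2) by (auto simp: bS c0_def mult.commute)
  qed
  have g: "g k \<in> lipball X z (\<eta> ^ k * (K + \<eta>))" "little_lip X (g k)" for k
    using G[of "\<eta> ^ k" "b k"] b[of k] \<eta>(1) by (auto simp: g_def)
  have geo: "(\<lambda>k. \<eta> ^ (k + m) * ((K + \<eta>) * D)) sums (\<eta> ^ m * L * D)" for m D
  proof -
    have "(\<lambda>k. \<eta> ^ k * (\<eta> ^ m * ((K + \<eta>) * D))) sums (1 / (1 - \<eta>) * (\<eta> ^ m * ((K + \<eta>) * D)))"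
      by (intro sums_mult2 geometric_sums) (use \<eta> in auto)
    moreover have "1 / (1 - \<eta>) * (\<eta> ^ m * ((K + \<eta>) * D)) = \<eta> ^ m * L * D"
      unfolding \<eta>(3) using \<eta>(2) by simp
    ultimately show ?thesis by (simp add: power_add mult.assoc)
  qed
  have gxy: "\<bar>g k x - g k y\<bar> \<le> \<eta> ^ k * ((K + \<eta>) * dist x y)" if "x \<in> X" "y \<in> X" for k x y
    using lipballD(2)[OF g(1) that, of k] by (simp add: mult.assoc)
  have summ: "summable (\<lambda>k. g k x)" if x: "x \<in> X" for x
  proof (rule summable_comparison_test')
    show "summable (\<lambda>k. \<eta> ^ k * ((K + \<eta>) * dist x z))" using geo[of 0] by (simp add: sums_iff)
    show "norm (g k x) \<le> \<eta> ^ k * ((K + \<eta>) * dist x z)" for k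
      using gxy[OF x zX, of k] lipballD(1)[OF g(1), of k] by simp
  qed
  define h where "h x = (\<Sum>k. g k x)" for x
  \<comment> \<open>One estimate with three uses: \<open>m = 0\<close> bounds the norm of
    \<open>h\<close>, large \<open>m\<close> gives its flatness and its interpolated values.\<close>
  have tail: "\<bar>(h x - h y) - (\<Sum>k<m. g k x - g k y)\<bar> \<le> \<eta> ^ m * L * dist x y"
    if xy: "x \<in> X" "y \<in> X" for x y m
  proof -
    have s: "summable (\<lambda>k. g k x - g k y)" using summ xy by (intro summable_diff)
    have "h x - h y = (\<Sum>k. g k x - g k y)" unfolding h_def using summ xy by (intro suminf_diff)
    also have "\<dots> = (\<Sum>k. g (k + m) x - g (k + m) y) + (\<Sum>k<m. g k x - g k y)"
      by (rule suminf_split_initial_segment[OF s])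
    finally have "(h x - h y) - (\<Sum>k<m. g k x - g k y) = (\<Sum>k. g (k + m) x - g (k + m) y)" by simp
    also have "\<bar>\<dots>\<bar> \<le> (\<Sum>k. \<eta> ^ (k + m) * ((K + \<eta>) * dist x y))"
      using norm_suminf_le[of "\<lambda>k. g (k + m) x - g (k + m) y" "\<lambda>k. \<eta> ^ (k + m) * ((K + \<eta>) * dist x y)"]
        gxy[OF xy] geo[of m "dist x y"] by (simp add: sums_iff)
    also have "\<dots> = \<eta> ^ m * L * dist x y" using geo[of m "dist x y"] by (simp add: sums_iff)
    finally show ?thesis .
  qed
  have small: "(\<lambda>m. \<eta> ^ m * c) \<longlonglongrightarrow> 0" for c
    using \<eta> by (intro tendsto_mult_left_zero LIMSEQ_power_zero) auto
  have "h \<in> lipball X z L"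
  proof (rule lipballI)
    show "h z = 0" using lipballD(1)[OF g(1)] by (simp add: h_def)
    show "\<bar>h x - h y\<bar> \<le> L * dist x y" if "x \<in> X" "y \<in> X" for x y
      using tail[OF that, of 0] by simp
  qed
  moreover have "little_lip X h"
  proof (rule little_lip_approx)
    fix e :: real assume "e > 0"
    then obtain m where m: "\<eta> ^ m * L < e"
      using LIMSEQ_D[OF small[of L] \<open>e > 0\<close>] by (force simp: abs_less_iff)
    have "\<bar>(h x - h y) - ((\<Sum>k<m. g k x) - (\<Sum>k<m. g k y))\<bar> \<le> e * dist x y" if "x \<in> X" "y \<in> X" for x y
    proof -
      have "\<eta> ^ m * L * dist x y \<le> e * dist x y" using m by (intro mult_right_mono) auto
      then show ?thesis using tail[OF that, of m] by (simp add: sum_subtractf)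
    qed
    then show "\<exists>h'. little_lip X h' \<and> (\<forall>x\<in>X. \<forall>y\<in>X. \<bar>(h x - h y) - (h' x - h' y)\<bar> \<le> e * dist x y)"
      by (intro exI[of _ "\<lambda>x. \<Sum>k<m. g k x"]) (auto intro: little_lip_sum g)
  qed
  moreover have "?T h = \<alpha>"
  proof
    fix n
    have part: "(\<Sum>k<m. ?T (g k) n) = \<alpha> n - b m n" for m
      by (induction m) (simp_all add: b0 bS)
    have "\<bar>?T h n - \<alpha> n\<bar> \<le> \<eta> ^ m * (L + 1)" for m
    proof -
      have "?T h n - (\<Sum>k<m. ?T (g k) n)
          = ((h (xs n) - h (ys n)) - (\<Sum>k<m. g k (xs n) - g k (ys n))) / dist (xs n) (ys n)"
        by (simp add: interp_op_def diff_divide_distrib sum_divide_distrib)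
      then have "\<bar>?T h n - (\<Sum>k<m. ?T (g k) n)\<bar> \<le> \<eta> ^ m * L"
        using tail[OF xsX ysX, of n n m] neq[of n] by (simp add: divide_le_eq)
      moreover have "\<bar>b m n\<bar> \<le> \<eta> ^ m" using b by blast
      ultimately show ?thesis unfolding part distrib_left by linarith
    qed
    then have "\<bar>?T h n - \<alpha> n\<bar> \<le> 0" by (intro LIMSEQ_le_const[OF small[of "L + 1"]]) auto
    then show "?T h n = \<alpha> n" by simp
  qed
  ultimately show ?thesis by blast
qed

section \<open>From constants to surjectivity and isomorphism; comparison of infima\<close>

lemma Lip_interpolating_of_constant:
  assumes K: "K \<in> c0_interp_constants X (Lip0 X z) xs ys"
  shows "Lip_interpolating X z xs ys"
  unfolding Lip_interpolating_def
proof
  fix \<alpha> assume "\<alpha> \<in> linfty"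
  then obtain B where B: "B > 0" "\<And>n. \<bar>\<alpha> n\<bar> \<le> B"
    unfolding linfty_def bounded_pos by auto
  then obtain f where f: "f \<in> lipball X z K" "interp_op xs ys f = (\<lambda>n. \<alpha> n / B)"
    using c0_constant_interpolation[OF K, of "\<lambda>n. \<alpha> n / B"] by (auto simp: field_simps)
  have "(\<lambda>x. B * f x) \<in> Lip0 X z"
    using lipball_subset_Lip0[OF lipball_scale[OF f(1) order_refl, of B]] B(1) by simp
  moreover have "interp_op xs ys (\<lambda>x. B * f x) = \<alpha>" using B(1) by (simp add: interp_op_scale f(2))
  ultimately show "\<exists>f\<in>Lip0 X z. interp_op xs ys f = \<alpha>" by blast
qed

lemma c0_interpolating_of_constant:
  assumes K: "K \<in> c0_interp_constants X (lip0 X z) xs ys"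
  shows "Lip_c0_interpolating (lip0 X z) xs ys"
  unfolding Lip_c0_interpolating_def
proof
  fix \<alpha> assume \<alpha>: "\<alpha> \<in> c0"
  then have "\<alpha> \<in> linfty" using c0_subset_linfty by blast
  then obtain B where B: "B > 0" "\<And>n. \<bar>\<alpha> n\<bar> \<le> B"
    unfolding linfty_def bounded_pos by auto
  have "(\<lambda>n. \<alpha> n / B) \<in> c0" using \<alpha> by (auto simp: c0_def intro: tendsto_divide_zero)
  moreover have "\<forall>n. \<bar>\<alpha> n / B\<bar> \<le> 1" using B by (simp add: field_simps)
  ultimately obtain f where f: "f \<in> lipball X z K" "little_lip X f" "interp_op xs ys f = (\<lambda>n. \<alpha> n / B)"
    using K[unfolded c0_constants_lip0_iff, THEN conjunct2, rule_format, of "\<lambda>n. \<alpha> n / B"] by blast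
  have "(\<lambda>x. B * f x) \<in> lip0 X z"
    using lipball_subset_Lip0[OF lipball_scale[OF f(1) order_refl, of B]] little_lip_scale[OF f(2)] B(1)
    by (simp add: lip0_iff)
  moreover have "interp_op xs ys (\<lambda>x. B * f x) = \<alpha>" using B(1) by (simp add: interp_op_scale f(3))
  ultimately show "\<exists>f\<in>lip0 X z. interp_op xs ys f = \<alpha>" by blast
qed

lemma Sop_into_isomorphism_of_constant:
  assumes "K \<in> c0_interp_constants X (Lip0 X z) xs ys"
  shows "Sop_into_isomorphism X z xs ys"
  unfolding Sop_into_isomorphism_def
proof (intro exI conjI ballI)
  have K: "K > 0" using c0_constant_ge_1[OF assms] by simp
  then show "1 / K > 0" by simp
  fix lam assume lam: "lam \<in> l1"
  show "1 / K * l1norm lam \<le> dual_norm X z (Sop xs ys lam)"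
    using c0_constant_lower_bound[OF assms lam] K by (simp add: field_simps)
  show "dual_norm X z (Sop xs ys lam) \<le> 1 * l1norm lam" using dual_norm_Sop_le[OF lam] by simp
qed

text \<open>The gap \<open>K < L\<close> is the room that the iteration consumes; it leaves infima
  unchanged.\<close>

lemma c0_constants_lip0_Lip0:
  assumes "compact X" "separates_points_uniformly X z"
  shows "c0_interp_constants X (lip0 X z) xs ys \<subseteq> c0_interp_constants X (Lip0 X z) xs ys"
    and "K \<in> c0_interp_constants X (Lip0 X z) xs ys \<Longrightarrow> K < L \<Longrightarrow> L \<in> c0_interp_constants X (lip0 X z) xs ys"
proof -
  show "c0_interp_constants X (lip0 X z) xs ys \<subseteq> c0_interp_constants X (Lip0 X z) xs ys"
    unfolding subset_iff c0_constants_lip0_iff c0_constants_Lip0_iff by blast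
  assume K: "K \<in> c0_interp_constants X (Lip0 X z) xs ys" and "K < L"
  obtain a where a: "a > 1" "\<forall>x\<in>X. \<forall>y\<in>X. \<exists>f \<in> lip0 X z. lipnorm X f \<le> a \<and> \<bar>f x - f y\<bar> = dist x y"
    using assms(2) unfolding separates_points_uniformly_def by blast
  then have sep: "\<exists>h\<in>lipball X z a. little_lip X h \<and> \<bar>h x - h y\<bar> = dist x y" if "x \<in> X" "y \<in> X" for x y
    using that lipnorm_le_iff[of _ a] lip0_iff[of _ X z] by metis
  show "L \<in> c0_interp_constants X (lip0 X z) xs ys"
    unfolding c0_constants_lip0_iff
    using exact_interpolation_little_lip[OF assms(1) sep _ K \<open>K < L\<close>] a(1) \<open>K < L\<close> c0_constant_ge_1[OF K]
    by auto
qed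

lemma Inf_c0_constants_lip0:
  assumes "compact X" "separates_points_uniformly X z"
  shows "c0_interp_constants X (lip0 X z) xs ys \<noteq> {} \<longleftrightarrow> c0_interp_constants X (Lip0 X z) xs ys \<noteq> {}"
    and "Inf (c0_interp_constants X (lip0 X z) xs ys) = Inf (c0_interp_constants X (Lip0 X z) xs ys)"
proof -
  let ?S = "c0_interp_constants X (lip0 X z) xs ys" and ?S' = "c0_interp_constants X (Lip0 X z) xs ys"
  note sub = c0_constants_lip0_Lip0[OF assms]
  show ne: "?S \<noteq> {} \<longleftrightarrow> ?S' \<noteq> {}" using sub(1) sub(2)[OF _ less_add_one] by blast
  have bdd: "bdd_below ?S'" using c0_constant_ge_1 by (intro bdd_belowI)
  show "Inf ?S = Inf ?S'"
  proof (cases "?S = {}")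
    case True
    then show ?thesis using ne by simp
  next
    case False
    show ?thesis
    proof (rule antisym)
      show "Inf ?S' \<le> Inf ?S" using False bdd sub(1) by (rule cInf_superset_mono)
      show "Inf ?S \<le> Inf ?S'"
      proof (rule dense_ge)
        fix L assume "Inf ?S' < L"
        \<comment> \<open>The infimum over \<open>Lip0\<close> is itself admissible, so each
          \<open>L\<close> above it is admissible for \<open>lip0\<close>.\<close>
        then have "L \<in> ?S" using sub(2) Inf_c0_constants_mem False ne by blast
        then show "Inf ?S \<le> L" by (rule cInf_lower) (rule bdd_below_mono[OF bdd sub(1)])
      qed
    qed
  qed
qed

end

theorem theorem4p6:
  fixes X :: "'a::metric_space set" and z :: 'a
    and xs ys :: "nat \<Rightarrow> 'a" and M :: real
  assumes "compact X" and "z \<in> X"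
    and "separates_points_uniformly X z"
    and "\<And>n. xs n \<in> X" and "\<And>n. ys n \<in> X" and "\<And>n. xs n \<noteq> ys n"
    and "inj (\<lambda>n. (xs n, ys n))"
    and "M \<ge> 1"
  shows
   "((Lip_interpolating X z xs ys \<and> Lip_interp_constants X z xs ys \<noteq> {}
        \<and> Lip_interp_constant X z xs ys = M)
     \<longleftrightarrow> (Sop_into_isomorphism X z xs ys \<and> 1 / M \<in> Sop_lower_constants X z xs ys
        \<and> (\<forall>J\<in>Sop_lower_constants X z xs ys. J \<le> 1 / M)))
  \<and> ((Lip_interpolating X z xs ys \<and> Lip_interp_constants X z xs ys \<noteq> {}
        \<and> Lip_interp_constant X z xs ys = M)
     \<longleftrightarrow> (Lip_c0_interpolating (lip0 X z) xs ys \<and> c0_interp_constants X (lip0 X z) xs ys \<noteq> {}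
        \<and> M = Inf (c0_interp_constants X (lip0 X z) xs ys)))
  \<and> ((Lip_interpolating X z xs ys \<and> Lip_interp_constants X z xs ys \<noteq> {}
        \<and> Lip_interp_constant X z xs ys = M)
     \<longleftrightarrow> (c0_interp_constants X (Lip0 X z) xs ys \<noteq> {}
        \<and> M = Inf (c0_interp_constants X (Lip0 X z) xs ys)))"
proof -
  interpret pointed_pairs X z xs ys by standard (use assms in auto)
  let ?S = "c0_interp_constants X (Lip0 X z) xs ys" and ?S' = "c0_interp_constants X (lip0 X z) xs ys"
  let ?i = "Lip_interpolating X z xs ys \<and> Lip_interp_constants X z xs ys \<noteq> {}
        \<and> Lip_interp_constant X z xs ys = M"
  have iv: "?i \<longleftrightarrow> ?S \<noteq> {} \<and> M = Inf ?S"
    unfolding Lip_interp_constant_def Lip_constants_eq_c0_constants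
    using Lip_interpolating_of_constant by blast
  moreover have "?S \<noteq> {} \<and> M = Inf ?S \<longleftrightarrow> Lip_c0_interpolating (lip0 X z) xs ys \<and> ?S' \<noteq> {} \<and> M = Inf ?S'"
    using Inf_c0_constants_lip0[OF assms(1,3)] c0_interpolating_of_constant by (metis ex_in_conv)
  moreover have "?S \<noteq> {} \<and> M = Inf ?S \<longleftrightarrow> Sop_into_isomorphism X z xs ys
      \<and> 1 / M \<in> Sop_lower_constants X z xs ys \<and> (\<forall>J\<in>Sop_lower_constants X z xs ys. J \<le> 1 / M)"
  proof -
    have bdd: "bdd_below ?S" using c0_constant_ge_1 by (intro bdd_belowI)
    \<comment> \<open>As the infimum is attained, (iv) says that \<open>M\<close> is the least
      admissible constant; reciprocals turn this into the maximum in (ii).\<close>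
    have "?S \<noteq> {} \<and> M = Inf ?S \<longleftrightarrow> M \<in> ?S \<and> (\<forall>K\<in>?S. M \<le> K)"
    proof
      assume "?S \<noteq> {} \<and> M = Inf ?S"
      then show "M \<in> ?S \<and> (\<forall>K\<in>?S. M \<le> K)" using Inf_c0_constants_mem cInf_lower[OF _ bdd] by blast
    next
      assume "M \<in> ?S \<and> (\<forall>K\<in>?S. M \<le> K)"
      then show "?S \<noteq> {} \<and> M = Inf ?S" using cInf_eq_minimum[of M ?S] by auto
    qed
    moreover have "M \<in> ?S \<longleftrightarrow> 1 / M \<in> Sop_lower_constants X z xs ys"
      using \<open>M \<ge> 1\<close> by (simp add: lower_constants_iff)
    moreover have "(\<forall>K\<in>?S. M \<le> K) \<longleftrightarrow> (\<forall>J\<in>Sop_lower_constants X z xs ys. J \<le> 1 / M)"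
    proof (intro iffI ballI)
      fix J assume "\<forall>K\<in>?S. M \<le> K" "J \<in> Sop_lower_constants X z xs ys"
      then have "J > 0" "M \<le> 1 / J" by (auto simp: lower_constants_iff)
      then show "J \<le> 1 / M" using \<open>M \<ge> 1\<close> by (simp add: field_simps)
    next
      fix K assume *: "\<forall>J\<in>Sop_lower_constants X z xs ys. J \<le> 1 / M" and K: "K \<in> ?S"
      have "K > 0" using c0_constant_ge_1[OF K] by simp
      moreover from this have "1 / K \<le> 1 / M" using * K by (simp add: lower_constants_iff)
      ultimately show "M \<le> K" using \<open>M \<ge> 1\<close> by (simp add: field_simps)
    qed
    ultimately show ?thesis using Sop_into_isomorphism_of_constant by blast
  qed
  ultimately show ?thesis by blast
qed

end
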